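(* Let $n,r,t$ be integers with $1 \leq t \leq r \leq n$, let $u$ be a non-negative real number such that $u > \frac{6-t}{3}$, and let $\mathbf{c} = (c_1, \dots, c_n)$ be an IP sequence with $c_1 \geq t+u+1$. If $\mathcal{A}$ is a $t$-intersecting subfamily of $\mathcal{S}_{\mathbf{c},r}$, then \[|\mathcal{A}| \leq \sum_{I \in \binom{[t+1,n]}{r-t}} \prod_{i \in I} c_i .\] Moreover, if $u > 0$, then the bound is attained if and only if $\mathcal{A} = \mathcal{S}_{\mathbf{c},r}(T)$ for some $T \in \mathcal{S}_{\mathbf{c},t}$ with $|\mathcal{S}_{\mathbf{c},r}(T)| = |\mathcal{S}_{\mathbf{c},r,t}|$.
   Context: For integers $a,b$, $[a,b]$ is the set of positive integers $i$ with $a \leq i \leq b$, and $[n]=[1,n]$. $\binom{X}{q}$ is the family of all $q$-element subsets of $X$ (an empty product equals $1$). An IP sequence is a finite sequence $(c_1,\dots,c_n)$ of positive integers with $c_1 \leq \dots \leq c_n$. For an IP sequence $\mathbf{c}=(c_1,\dots,c_n)$ and $r \in [n]$, $\mathcal{S}_{\mathbf{c},r}$ is the family of all sets $\{(x_1,y_{x_1}),\dots,(x_r,y_{x_r})\}$ of pairs such that $\{x_1,\dots,x_r\} \in \binom{[n]}{r}$ (so $x_1,\dots,x_r$ are distinct) and $y_{x_j} \in [c_{x_j}]$ for each $j \in [r]$. For a family $\mathcal{F}$ and a set $T$, $\mathcal{F}(T) = \{F \in \mathcal{F} : T \subseteq F\}$. For $t \in [r]$, $\mathcal{S}_{\mathbf{c},r,t}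 = \{A \in \mathcal{S}_{\mathbf{c},r} : (x,1) \in A \text{ for each } x \in [t]\}$. A family $\mathcal{A}$ of sets is $t$-intersecting if $|A \cap B| \geq t$ for every two sets $A,B \in \mathcal{A}$. *)

theory Defs
  imports Complex_Main "HOL-Library.Ramsey"
begin

text \<open>A sequence \<open>(c\<^sub>1, \<dots>, c\<^sub>n)\<close> is a function \<open>c :: nat \<Rightarrow> nat\<close> of which only the values on
  \<open>{1..n}\<close> matter. The family of all \<open>q\<close>-element subsets of \<open>X\<close> is \<^const>\<open>nsets\<close> \<open>X q\<close>.\<close>

definition IP_sequence :: "nat \<Rightarrow> (nat \<Rightarrow> nat) \<Rightarrow> bool" where
  "IP_sequence n c \<longleftrightarrow>
     (\<forall>i\<in>{1..n}. 0 < c i) \<and> (\<forall>i\<in>{1..n}. \<forall>j\<in>{1..n}. i \<le> j \<longrightarrow> c i \<le> c j)"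

definition signed_sets :: "nat \<Rightarrow> (nat \<Rightarrow> nat) \<Rightarrow> nat \<Rightarrow> (nat \<times> nat) set set" where
  "signed_sets n c r =
     {(\<lambda>x. (x, y x)) ` X | X y. X \<in> nsets {1..n} r \<and> (\<forall>x\<in>X. y x \<in> {1..c x})}"

definition star :: "'a set set \<Rightarrow> 'a set \<Rightarrow> 'a set set" where
  "star \<F> T = {F \<in> \<F>. T \<subseteq> F}"

definition signed_sets_fix :: "nat \<Rightarrow> (nat \<Rightarrow> nat) \<Rightarrow> nat \<Rightarrow> nat \<Rightarrow> (nat \<times> nat) set set" where
  "signed_sets_fix n c r t = {A \<in> signed_sets n c r. \<forall>x\<in>{1..t}. (x, 1) \<in> A}"

text \<open>The two sets may coincide; for families of finite sets of size at least \<open>t\<close> this makes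
  no difference.\<close>

definition t_intersecting :: "nat \<Rightarrow> 'a set set \<Rightarrow> bool" where
  "t_intersecting t \<A> \<longleftrightarrow> (\<forall>A\<in>\<A>. \<forall>B\<in>\<A>. t \<le> card (A \<inter> B))"

end

theory Submission
  imports Defs "HOL-Combinatorics.Transposition"
begin

text \<open>
  Shifting turns the statement about signed sets into one about weighted families of subsets of
  \<open>{1..n}\<close>. Replacing \<open>(x, y)\<close> by \<open>(x, 1)\<close> wherever this creates no duplicate keeps the size of
  the family and the \<open>t\<close>-intersection property. Once no such replacement changes the family, any
  two members already agree in \<open>t\<close> pairs with value 1 (\<open>t_intersecting_ones\<close>): a common pair \<open>(x, y)\<close> with
  \<open>y \<noteq> 1\<close> can be destroyed by moving one of the two members to \<open>(x, 1)\<close>. So the traces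
  \<open>T = {x. (x, 1) \<in> A}\<close> form a \<open>t\<close>-intersecting family, and the size of \<open>\<A>\<close> is at most the sum over
  these \<open>T\<close> of the number \<open>g T\<close> of signed sets with trace \<open>T\<close>.

  The weight \<open>g\<close> drops at least by the factor \<open>c 1 - 1 \<ge> t + u\<close> each time a point joins \<open>T\<close>,
  because a value 1 can be replaced by any of the other values, and it does not decrease when a
  point of \<open>T\<close> is moved to the left, because \<open>c\<close> is increasing. For such weights no \<open>t\<close>-intersecting
  family is heavier than the family of all supersets of \<open>{1..t}\<close> (\<open>weighted_t_intersecting\<close>). This is
  proved by induction on \<open>n\<close>, in the manner of Ahlswede and Khachatrian. In a family that is stable
  under the shifts \<open>j \<rightarrow> i\<close> with \<open>i < j\<close>, two members that contain the last point \<open>N\<close> and meet in exactly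
  \<open>t\<close> points cover \<open>{1..N}\<close>, so their sizes add up to \<open>N + t\<close>. If there are such pairs, one can add
  \<open>A - {N}\<close> for some of the members \<open>A\<close> involved and discard their partners, and the factor \<open>t + u\<close>
  makes up for the loss (\<open>exchange_increases_weight\<close>). If there are none, \<open>N\<close> can be deleted from all members, and
  the induction hypothesis applies to the marginal weight on \<open>{1..N - 1}\<close>.

  For \<open>u > 0\<close> every exchange is a strict gain, so an extremal family turns into a star, that is, the
  family of all supersets of a core \<open>T\<close> of size \<open>t\<close>, through shifts and deletions of the last point
  alone. Both can be undone within the stars. For a shift \<open>q \<rightarrow> p\<close> with \<open>p \<in> T\<close> this is
  \<open>unshift_star\<close>: before the shift, each member without \<open>q\<close> was present either as it is or with \<open>q\<close> in
  place of \<open>p\<close>, and sets of different kinds must meet outside the core. As any two members have a third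
  one that meets both of them in the core only, all are of the same kind.
\<close>

section \<open>Shifting families of sets\<close>

definition moved :: "'a \<Rightarrow> 'a \<Rightarrow> 'a set set \<Rightarrow> 'a set \<Rightarrow> bool" where
  "moved p q \<A> A \<longleftrightarrow> q \<in> A \<and> p \<notin> A \<and> insert p (A - {q}) \<notin> \<A>"

definition shift_map :: "'a \<Rightarrow> 'a \<Rightarrow> 'a set set \<Rightarrow> 'a set \<Rightarrow> 'a set" where
  "shift_map p q \<A> A = (if moved p q \<A> A then insert p (A - {q}) else A)"

text \<open>This is the shifting operator of Erdos, Ko and Rado.  Leaving a set alone when its
  image is already a member keeps the operation injective on the family.\<close>

definition shift :: "'a \<Rightarrow> 'a \<Rightarrow> 'a set set \<Rightarrow> 'a set set" where
  "shift p q \<A> = shift_map p q \<A> ` \<A>"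

lemma inj_on_shift_map: "inj_on (shift_map p q \<A>) \<A>"
proof (rule inj_onI)
  fix A B assume AB: "A \<in> \<A>" "B \<in> \<A>" and eq: "shift_map p q \<A> A = shift_map p q \<A> B"
  consider "moved p q \<A> A" "moved p q \<A> B" | "moved p q \<A> A" "\<not> moved p q \<A> B"
    | "\<not> moved p q \<A> A" "moved p q \<A> B" | "\<not> moved p q \<A> A" "\<not> moved p q \<A> B"
    by blast
  then show "A = B"
  proof cases
    case 1
    then have "insert p (A - {q}) = insert p (B - {q})"
      using eq by (simp add: shift_map_def)
    moreover have "q \<in> A" "p \<notin> A" "q \<in> B" "p \<notin> B"
      using 1 by (auto simp: moved_def)
    then have "A = insert q (insert p (A - {q}) - {p})" "B = insert q (insert p (B - {q}) - {p})"
      by blast+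
    ultimately show ?thesis by simp
  qed (use AB eq in \<open>auto simp: shift_map_def moved_def\<close>)
qed

lemma card_shift: "card (shift p q \<A>) = card \<A>"
  unfolding shift_def by (rule card_image[OF inj_on_shift_map])

lemma sum_shift: "sum g (shift p q \<A>) = (\<Sum>A\<in>\<A>. g (shift_map p q \<A> A))"
  unfolding shift_def by (simp add: sum.reindex[OF inj_on_shift_map])

lemma shift_eqI: "(\<And>A. A \<in> \<A> \<Longrightarrow> \<not> moved p q \<A> A) \<Longrightarrow> shift p q \<A> = \<A>"
  by (force simp: shift_def shift_map_def)

lemma shift_fixedD:
  assumes "shift p q \<A> = \<A>" "A \<in> \<A>" "q \<in> A" "p \<notin> A"
  shows "insert p (A - {q}) \<in> \<A>"
proof (rule ccontr)
  assume "insert p (A - {q}) \<notin> \<A>"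
  then have "shift_map p q \<A> A = insert p (A - {q})"
    using assms by (simp add: shift_map_def moved_def)
  then have "insert p (A - {q}) \<in> shift p q \<A>"
    using assms(2) by (metis shift_def imageI)
  then show False
    using assms(1) \<open>insert p (A - {q}) \<notin> \<A>\<close> by simp
qed

lemma card_swap:
  assumes "finite A" "q \<in> A" "p \<notin> A"
  shows "card (insert p (A - {q})) = card A"
  using assms by (metis DiffD1 card_Suc_Diff1 card_insert_disjoint finite_Diff)

text \<open>The critical case is a member \<open>A\<close> that moves and a member \<open>B\<close> that contains \<open>q\<close> but not \<open>p\<close>
  and stays: then the image of \<open>B\<close> is itself a member, and it meets \<open>A\<close> in as many points as \<open>B\<close>
  meets the image of \<open>A\<close>.\<close>

lemma t_intersecting_shift:
  assumes fin: "\<And>A. A \<in> \<A> \<Longrightarrow> finite A" and pq: "p \<noteq> q" and int: "t_intersecting t \<A>"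
  shows "t_intersecting t (shift p q \<A>)"
proof -
  have int': "t \<le> card (A \<inter> B)" if "A \<in> \<A>" "B \<in> \<A>" for A B
    using int that by (auto simp: t_intersecting_def)
  have one: "t \<le> card (insert p (A - {q}) \<inter> B)"
    if A: "A \<in> \<A>" "moved p q \<A> A" and B: "B \<in> \<A>" "\<not> moved p q \<A> B" for A B
  proof -
    have qA: "q \<in> A" "p \<notin> A" using A by (auto simp: moved_def)
    consider "q \<notin> B" | "q \<in> B" "p \<in> B" | "q \<in> B" "p \<notin> B" by blast
    then show ?thesis
    proof cases
      case 1
      then have "A \<inter> B \<subseteq> insert p (A - {q}) \<inter> B" by blast
      then show ?thesis
        using card_mono[of "insert p (A - {q}) \<inter> B" "A \<inter> B"] int'[OF A(1) B(1)] fin[OF B(1)] by simp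
    next
      case 2
      then have "insert p (A - {q}) \<inter> B = insert p (A \<inter> B - {q})" by blast
      then show ?thesis
        using card_swap[of "A \<inter> B"] 2 qA int'[OF A(1) B(1)] fin[OF B(1)] by simp
    next
      case 3
      then have B': "insert p (B - {q}) \<in> \<A>" using B by (simp add: moved_def)
      have "insert p (A - {q}) \<inter> B = A \<inter> insert p (B - {q})" using 3 qA by blast
      then show ?thesis using int'[OF A(1) B'] by simp
    qed
  qed
  have "t \<le> card (shift_map p q \<A> A \<inter> shift_map p q \<A> B)" if AB: "A \<in> \<A>" "B \<in> \<A>" for A B
  proof -
    consider "moved p q \<A> A" "moved p q \<A> B" | "moved p q \<A> A" "\<not> moved p q \<A> B"
      | "\<not> moved p q \<A> A" "moved p q \<A> B" | "\<not> moved p q \<A> A" "\<not> moved p q \<A> B"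
      by blast
    then show ?thesis
    proof cases
      case 1
      then have "q \<in> A" "p \<notin> A" "q \<in> B" "p \<notin> B" by (auto simp: moved_def)
      moreover have "insert p (A - {q}) \<inter> insert p (B - {q}) = insert p (A \<inter> B - {q})" by blast
      ultimately show ?thesis
        using 1 card_swap[of "A \<inter> B"] int'[OF AB] fin[OF AB(1)] by (simp add: shift_map_def)
    next
      case 2
      then show ?thesis using one[of A B] AB by (simp add: shift_map_def)
    next
      case 3
      then show ?thesis using one[of B A] AB by (simp add: shift_map_def Int_commute)
    next
      case 4
      then show ?thesis using int'[OF AB] by (simp add: shift_map_def)
    qed
  qed
  then show ?thesis by (auto simp: t_intersecting_def shift_def)
qed

lemma sum_shift_mono:
  fixes g :: "'a set \<Rightarrow> real"
  assumes "\<And>A. A \<in> \<A> \<Longrightarrow> q \<in> A \<Longrightarrow> p \<notin> A \<Longrightarrow> g A \<le> g (insert p (A - {q}))"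
  shows "sum g \<A> \<le> sum g (shift p q \<A>)"
  unfolding sum_shift by (rule sum_mono) (use assms in \<open>auto simp: shift_map_def moved_def\<close>)

text \<open>The potential that makes repeated shifting terminate.\<close>

lemma shift_decreases:
  fixes f :: "'a \<Rightarrow> nat"
  assumes fin: "finite \<A>" "\<And>A. A \<in> \<A> \<Longrightarrow> finite A" and f: "f p < f q" and ne: "shift p q \<A> \<noteq> \<A>"
  shows "(\<Sum>A\<in>shift p q \<A>. sum f A) < (\<Sum>A\<in>\<A>. sum f A)"
proof -
  have less: "sum f (insert p (A - {q})) < sum f A" if "A \<in> \<A>" "q \<in> A" "p \<notin> A" for A
    using that fin(2)[OF that(1)] f by (simp add: sum.remove)
  obtain A where "A \<in> \<A>" "moved p q \<A> A"
    using ne shift_eqI by metis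
  then show ?thesis
    unfolding sum_shift
    by (intro sum_strict_mono_ex1[OF fin(1)])
       (use less in \<open>auto simp: shift_map_def moved_def intro: less_imp_le\<close>)
qed

text \<open>Suppose that shifting produced the star of \<open>T\<close>. Only the case \<open>p \<in> T\<close>, \<open>q \<notin> T\<close> is of
  interest, as otherwise no member can have moved. Each member of the star that avoids \<open>q\<close> either was
  present before the shift or was obtained from a set with \<open>q\<close> in place of \<open>p\<close>. If \<open>X\<close> is of the second
  kind and \<open>Y\<close> of the first, a set \<open>Z\<close> that meets both in \<open>T\<close> only can be of neither kind, as two sets of
  different kinds would then share just the \<open>t - 1\<close> points of \<open>T - {p}\<close>. Hence all are of the same
  kind. The assumption \<open>sep\<close> provides \<open>Z\<close>.\<close>

lemma unshift_star:
  assumes sub: "\<A> \<subseteq> \<P>" and int: "t_intersecting t \<A>" and T: "finite T" "card T = t" and pq: "p \<noteq> q"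
    and star: "shift p q \<A> = star \<P> T"
    and host: "\<And>A. A \<in> \<P> \<Longrightarrow> q \<in> A \<Longrightarrow> p \<notin> A \<Longrightarrow> insert p (A - {q}) \<in> \<P>"
    and sep: "\<And>X Y. \<lbrakk>p \<in> T; q \<notin> T; X \<in> \<P>; Y \<in> \<P>; T \<subseteq> X; T \<subseteq> Y; q \<notin> X; q \<notin> Y\<rbrakk>
      \<Longrightarrow> \<exists>Z\<in>\<P>. T \<subseteq> Z \<and> q \<notin> Z \<and> Z \<inter> X = T \<and> Z \<inter> Y = T"
  shows "\<A> = star \<P> T \<or> p \<in> T \<and> q \<notin> T \<and> \<A> = star \<P> (insert q (T - {p}))"
proof -
  have stay: "A \<in> star \<P> T" if "A \<in> \<A>" "\<not> moved p q \<A> A" for A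
    using that star by (force simp: shift_def shift_map_def)
  have move: "insert p (A - {q}) \<in> star \<P> T" if "A \<in> \<A>" "moved p q \<A> A" for A
    using that star by (force simp: shift_def shift_map_def)
  have origin: "F \<in> \<A> \<and> \<not> moved p q \<A> F \<or> (\<exists>A\<in>\<A>. moved p q \<A> A \<and> F = insert p (A - {q}))"
    if "F \<in> star \<P> T" for F
    using that unfolding star[symmetric] shift_def shift_map_def by (auto split: if_splits)
  show ?thesis
  proof (cases "p \<in> T \<and> q \<notin> T")
    case False
    have "\<not> moved p q \<A> A" if "A \<in> \<A>" for A
    proof
      assume m: "moved p q \<A> A"
      then have A: "q \<in> A" "p \<notin> A" by (auto simp: moved_def)
      from move[OF that m] have "T \<subseteq> insert p (A - {q})" by (simp add: star_def)
      then have "q \<notin> T" using pq by blast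
      then have "p \<notin> T" using False by simp
      then have "A \<in> star \<P> T"
        using \<open>T \<subseteq> insert p (A - {q})\<close> that sub by (auto simp: star_def)
      with origin[of A] m A show False by (auto simp: moved_def)
    qed
    then show ?thesis using shift_eqI[of \<A> p q] star by simp
  next
    case True
    then have pT: "p \<in> T" and qT: "q \<notin> T" by auto
    have up: "F \<in> \<A>" if "F \<in> star \<P> T" "q \<in> F" for F
      using origin[OF that(1)] that pq by auto
    have swapped: "insert q (F - {p}) \<in> \<A>" if F: "F \<in> star \<P> T" "q \<notin> F" "F \<notin> \<A>" for F
    proof -
      obtain A where "A \<in> \<A>" "moved p q \<A> A" "F = insert p (A - {q})" using origin[OF F(1)] F(3) by auto
      moreover from this have "insert q (F - {p}) = A" by (auto simp: moved_def)
      ultimately show ?thesis by simp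
    qed
    \<comment> \<open>Sets of different kinds cannot meet in the core alone.\<close>
    have meet: False if "X \<in> \<A>" "Y \<in> \<A>" "X \<inter> Y \<subseteq> T - {p}" for X Y
    proof -
      have "t \<le> card (X \<inter> Y)" using int that by (auto simp: t_intersecting_def)
      also have "\<dots> \<le> card (T - {p})" using that T by (intro card_mono) auto
      also have "\<dots> < t" using T pT by (metis card_Diff1_less)
      finally show False by simp
    qed
    show ?thesis
    proof (cases "\<forall>F\<in>star \<P> T. q \<notin> F \<longrightarrow> F \<in> \<A>")
      case all: True
      have "star \<P> T \<subseteq> \<A>" using all up by blast
      moreover have "A \<in> star \<P> T" if "A \<in> \<A>" for A
      proof (cases "moved p q \<A> A")
        case True
        then have "insert p (A - {q}) \<in> \<A>"
          using move[OF that True] all pq by auto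
        then show ?thesis using True by (simp add: moved_def)
      qed (rule stay[OF that])
      ultimately show ?thesis by blast
    next
      case False
      then obtain X where X: "X \<in> star \<P> T" "q \<notin> X" "X \<notin> \<A>" by blast
      have none: "Y \<notin> \<A>" if Y: "Y \<in> star \<P> T" "q \<notin> Y" for Y
      proof
        assume YA: "Y \<in> \<A>"
        obtain Z where Z: "Z \<in> \<P>" "T \<subseteq> Z" "q \<notin> Z" "Z \<inter> X = T" "Z \<inter> Y = T"
          using sep[OF pT qT, of X Y] X Y by (auto simp: star_def)
        show False
        proof (cases "Z \<in> \<A>")
          case True
          show False by (rule meet[OF True swapped[OF X]]) (use Z in auto)
        next
          case False
          have "insert q (Z - {p}) \<in> \<A>"
            by (rule swapped) (use Z False in \<open>auto simp: star_def\<close>)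
          then show False by (rule meet[OF _ YA]) (use Z Y in auto)
        qed
      qed
      have "F \<in> \<A>" if F: "F \<in> \<P>" "insert q (T - {p}) \<subseteq> F" for F
      proof (cases "p \<in> F")
        case True
        then show ?thesis using up[of F] F pT by (auto simp: star_def)
      next
        case False
        let ?G = "insert p (F - {q})"
        have G: "?G \<in> star \<P> T" using host[of F] F False qT by (auto simp: star_def)
        have "q \<notin> ?G" using pq by simp
        then have "insert q (?G - {p}) \<in> \<A>" using swapped[OF G] none[OF G] by simp
        moreover have "insert q (?G - {p}) = F" using F False by auto
        ultimately show ?thesis by simp
      qed
      moreover have "insert q (T - {p}) \<subseteq> A" if A: "A \<in> \<A>" for A
      proof (cases "moved p q \<A> A")
        case True
        then show ?thesis using move[OF A True] by (auto simp: star_def moved_def)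
      next
        case False
        then have "A \<in> star \<P> T" using stay A by blast
        moreover from this have "q \<in> A" using none A by blast
        ultimately show ?thesis by (auto simp: star_def)
      qed
      ultimately have "\<A> = star \<P> (insert q (T - {p}))" using sub by (auto simp: star_def)
      then show ?thesis using pT qT by simp
    qed
  qed
qed

section \<open>Weighted families of subsets\<close>

text \<open>Adding \<open>A - {m}\<close> for the members \<open>A\<close> of \<open>\<D>\<close> endangers only pairs that both contain \<open>m\<close> and
  meet in exactly \<open>t\<close> points. It is harmless when all partners of \<open>\<D>\<close> in such pairs are discarded with \<open>\<E>\<close>
  and none of them lies in \<open>\<D>\<close> itself.\<close>

lemma t_intersecting_exchange:
  assumes fin: "\<And>A. A \<in> \<T> \<Longrightarrow> finite A" and int: "t_intersecting t \<T>"
    and D: "\<D> \<subseteq> \<T>" "\<And>A. A \<in> \<D> \<Longrightarrow> m \<in> A"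
    and tight: "\<And>A B. \<lbrakk>A \<in> \<D>; B \<in> \<T>; m \<in> B; card (A \<inter> B) = t\<rbrakk> \<Longrightarrow> B \<in> \<E> \<and> B \<notin> \<D>"
  shows "t_intersecting t ((\<T> - \<E>) \<union> (\<lambda>A. A - {m}) ` \<D>)"
proof -
  have int': "t \<le> card (A \<inter> B)" if "A \<in> \<T>" "B \<in> \<T>" for A B
    using int that by (auto simp: t_intersecting_def)
  have drop: "t \<le> card (A \<inter> B - {m})"
    if "A \<in> \<D>" "B \<in> \<T>" "B \<in> \<D> \<or> B \<notin> \<E>" for A B
  proof (cases "m \<in> B")
    case True
    then have "card (A \<inter> B) \<noteq> t" using tight[of A B] that by auto
    moreover have "t \<le> card (A \<inter> B)" using int' that D by auto
    ultimately show ?thesis using True D that by (simp add: card_Diff_singleton)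
  next
    case False
    then have "A \<inter> B - {m} = A \<inter> B" by blast
    then show ?thesis using int'[of A B] that D by auto
  qed
  have 1: "t \<le> card ((A - {m}) \<inter> B) \<and> t \<le> card (B \<inter> (A - {m}))"
    if "A \<in> \<D>" "B \<in> \<T>" "B \<notin> \<E>" for A B
  proof -
    have "(A - {m}) \<inter> B = A \<inter> B - {m}" "B \<inter> (A - {m}) = A \<inter> B - {m}" by blast+
    then show ?thesis using drop[of A B] that by simp
  qed
  have 2: "t \<le> card ((A - {m}) \<inter> (B - {m}))" if "A \<in> \<D>" "B \<in> \<D>" for A B
  proof -
    have "(A - {m}) \<inter> (B - {m}) = A \<inter> B - {m}" by blast
    then show ?thesis using drop[of A B] that D by auto
  qed
  show ?thesis
    unfolding t_intersecting_def
    using 1 2 int' by (auto simp: ball_Un)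
qed

definition bounded_subsets :: "nat \<Rightarrow> nat \<Rightarrow> nat set set" where
  "bounded_subsets n r = {A. A \<subseteq> {1..n} \<and> card A \<le> r}"

text \<open>The model is the weight that gives \<open>A\<close> the number of signed sets of size \<open>r\<close> whose value is 1
  exactly at the coordinates in \<open>A\<close>; it vanishes beyond size \<open>r\<close>, which is why positivity is asked
  for up to size \<open>r\<close> only. Decay starts at size \<open>t\<close> because the members of a \<open>t\<close>-intersecting family
  have at least that size.\<close>

definition decaying_weight :: "nat \<Rightarrow> nat \<Rightarrow> nat \<Rightarrow> real \<Rightarrow> (nat set \<Rightarrow> real) \<Rightarrow> bool" where
  "decaying_weight n r t \<tau> g \<longleftrightarrow>
     (\<forall>A\<subseteq>{1..n}. 0 \<le> g A \<and> (card A \<le> r \<longrightarrow> 0 < g A)) \<and>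
     (\<forall>A\<subseteq>{1..n}. \<forall>x\<in>{1..n} - A. t \<le> card A \<longrightarrow> \<tau> * g (insert x A) \<le> g A) \<and>
     (\<forall>A\<subseteq>{1..n}. \<forall>i\<in>{1..n} - A. \<forall>j\<in>A. i < j \<longrightarrow> g A \<le> g (insert i (A - {j})))"

lemma finite_bounded_subsets: "finite (bounded_subsets n r)"
  unfolding bounded_subsets_def by (rule finite_subset[of _ "Pow {1..n}"]) auto

text \<open>Let \<open>\<C>\<close> consist of the members that contain \<open>N\<close> and have a partner with which they share \<open>N\<close>
  and meet in exactly \<open>t\<close> points. By shiftedness partners cover \<open>{1..N}\<close>, so their sizes add up to
  \<open>N + t\<close>. If some size \<open>i\<close> other than \<open>(N + t) / 2\<close> occurs, partners of sets of size \<open>i\<close> have a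
  different size, and of the two size classes the heavier one is copied without \<open>N\<close> while the
  lighter one is discarded. Otherwise all sets in \<open>\<C>\<close> have size \<open>(N + t) / 2\<close>; then those that miss a
  suitable point \<open>j\<close> are copied without \<open>N\<close> while the others are discarded. No two of the former are partners, as they
  do not cover \<open>j\<close>.\<close>

lemma exchange_increases_weight:
  fixes g :: "nat set \<Rightarrow> real" and \<tau> :: real and n :: nat
  defines "N \<equiv> Suc n"
  assumes t: "1 \<le> t" "t \<le> n" and \<tau>: "real t \<le> \<tau>" and g: "decaying_weight N r t \<tau> g"
    and sub: "\<T> \<subseteq> bounded_subsets N r" and int: "t_intersecting t \<T>"
    and shifted: "\<And>i j. \<lbrakk>1 \<le> i; i < j; j \<le> N\<rbrakk> \<Longrightarrow> shift i j \<T> = \<T>"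
    and tight: "A0 \<in> \<T>" "B0 \<in> \<T>" "N \<in> A0" "N \<in> B0" "card (A0 \<inter> B0) = t"
  obtains \<T>' where "\<T>' \<subseteq> bounded_subsets N r" "t_intersecting t \<T>'"
    "card {A \<in> \<T>'. N \<in> A} < card {A \<in> \<T>. N \<in> A}"
    "sum g \<T> \<le> sum g \<T>'" "real t < \<tau> \<Longrightarrow> sum g \<T> < sum g \<T>'"
proof -
  have finT: "finite \<T>" using sub finite_bounded_subsets finite_subset by blast
  have T: "A \<subseteq> {1..N}" "card A \<le> r" "finite A" if "A \<in> \<T>" for A
    using that sub by (auto simp: bounded_subsets_def dest: finite_subset)
  have int': "t \<le> card (A \<inter> B)" if "A \<in> \<T>" "B \<in> \<T>" for A B
    using int that by (auto simp: t_intersecting_def)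
  have cover: "A \<union> B = {1..N}"
    if AB: "A \<in> \<T>" "B \<in> \<T>" "N \<in> A" "N \<in> B" "card (A \<inter> B) = t" for A B
  proof (rule ccontr)
    assume "A \<union> B \<noteq> {1..N}"
    then obtain k where k: "k \<in> {1..N}" "k \<notin> A" "k \<notin> B" using T AB by blast
    then have "1 \<le> k" "k < N" using AB by (auto simp: nat_less_le)
    \<comment> \<open>Shifting \<open>N\<close> to an uncovered point would destroy one of the \<open>t\<close> common points.\<close>
    then have "insert k (A - {N}) \<in> \<T>"
      using shift_fixedD[OF shifted] AB k by auto
    then have "t \<le> card (insert k (A - {N}) \<inter> B)" using int' AB by blast
    also have "insert k (A - {N}) \<inter> B = A \<inter> B - {N}" using k by blast
    also have "card \<dots> < t" using AB t by (simp add: card_Diff_singleton)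
    finally show False by simp
  qed
  define \<C> where "\<C> = {A \<in> \<T>. N \<in> A \<and> (\<exists>B\<in>\<T>. N \<in> B \<and> card (A \<inter> B) = t)}"
  have CT: "\<C> \<subseteq> \<T>" by (auto simp: \<C>_def)
  have CN: "N \<in> A" if "A \<in> \<C>" for A using that unfolding \<C>_def by blast
  have C_partner: "\<exists>B\<in>\<T>. N \<in> B \<and> card (A \<inter> B) = t" if "A \<in> \<C>" for A
    using that unfolding \<C>_def by blast
  have finC: "finite \<C>" by (rule finite_subset[OF CT finT])
  have partner: "B \<in> \<C>" if "A \<in> \<T>" "N \<in> A" "B \<in> \<T>" "N \<in> B" "card (A \<inter> B) = t" for A B
    using that by (auto simp: \<C>_def Int_commute)
  have sizes: "card A + card B = N + t"
    if "A \<in> \<T>" "B \<in> \<T>" "N \<in> A" "N \<in> B" "card (A \<inter> B) = t" for A B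
    using card_Un_Int[of A B] cover[OF that] T that by simp
  have big: "t < card A" if A: "A \<in> \<C>" for A
  proof -
    have "t \<le> card A" using int'[of A A] A CT by auto
    moreover have "card A \<noteq> t"
      using sizes[of A A] A t by (auto simp: \<C>_def N_def)
    ultimately show ?thesis by simp
  qed
  have new: "A - {N} \<notin> \<T>" if "A \<in> \<C>" for A
  proof
    assume "A - {N} \<in> \<T>"
    obtain B where B: "B \<in> \<T>" "N \<in> B" "card (A \<inter> B) = t" and A: "N \<in> A"
      using \<open>A \<in> \<C>\<close> by (auto simp: \<C>_def)
    have "t \<le> card ((A - {N}) \<inter> B)" using int' \<open>A - {N} \<in> \<T>\<close> B by blast
    also have "(A - {N}) \<inter> B = A \<inter> B - {N}" by blast
    also have "card \<dots> < t" using A B t by (simp add: card_Diff_singleton)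
    finally show False by simp
  qed
  have ratio: "\<tau> * g A \<le> g (A - {N})" if A: "A \<in> \<C>" for A
  proof -
    have "N \<in> A" "A \<subseteq> {1..N}" using A T CT by (auto simp: \<C>_def)
    moreover have "t \<le> card (A - {N})" using big[OF A] \<open>N \<in> A\<close> by (simp add: card_Diff_singleton)
    moreover have "N \<in> {1..N} - (A - {N})" by (simp add: N_def)
    moreover have "insert N (A - {N}) = A" using \<open>N \<in> A\<close> by blast
    ultimately show ?thesis using g unfolding decaying_weight_def by (metis Diff_subset subset_trans)
  qed
  have pos: "0 < g A" if "A \<in> \<T>" for A
    using g T that by (auto simp: decaying_weight_def)
  have sum_pos: "0 < sum g \<D>" if "\<D> \<subseteq> \<C>" "\<D> \<noteq> {}" for \<D>
    using that finC CT pos by (intro sum_pos) (auto dest: finite_subset)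
  have "\<exists>\<D> \<E>. \<D> \<subseteq> \<C> \<and> \<E> \<subseteq> \<C> \<and> \<D> \<noteq> {} \<and>
      (\<forall>A\<in>\<D>. \<forall>B\<in>\<T>. N \<in> B \<longrightarrow> card (A \<inter> B) = t \<longrightarrow> B \<in> \<E> \<and> B \<notin> \<D>) \<and>
      sum g \<E> \<le> \<tau> * sum g \<D> \<and> (real t < \<tau> \<longrightarrow> sum g \<E> < \<tau> * sum g \<D>)"
  proof (cases "\<exists>A\<in>\<C>. 2 * card A \<noteq> N + t")
    case True
    define layer where "layer i = {A \<in> \<C>. card A = i}" for i
    obtain A where A: "A \<in> \<C>" "2 * card A \<noteq> N + t" using True by blast
    obtain B where B: "B \<in> \<T>" "N \<in> B" "card (A \<inter> B) = t" using A by (auto simp: \<C>_def)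
    have BC: "B \<in> \<C>" using A B by (intro partner[of A]) (auto simp: \<C>_def)
    have AB: "card A + card B = N + t" using A B by (intro sizes) (auto simp: \<C>_def)
    have "\<exists>i. 2 * i \<noteq> N + t \<and> layer i \<noteq> {} \<and> sum g (layer (N + t - i)) \<le> sum g (layer i)"
    proof (cases "sum g (layer (card B)) \<le> sum g (layer (card A))")
      case True
      moreover have "N + t - card A = card B" using AB by simp
      ultimately show ?thesis using A by (intro exI[of _ "card A"]) (auto simp: layer_def)
    next
      case False
      moreover have "N + t - card B = card A" "2 * card B \<noteq> N + t" using AB A by auto
      ultimately show ?thesis using BC by (intro exI[of _ "card B"]) (auto simp: layer_def)
    qed
    then obtain i where i: "2 * i \<noteq> N + t" "layer i \<noteq> {}"
      "sum g (layer (N + t - i)) \<le> sum g (layer i)" by blast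
    have "0 < sum g (layer i)" using i by (intro sum_pos) (auto simp: layer_def)
    then have scale: "1 * sum g (layer i) \<le> \<tau> * sum g (layer i)"
      "real t < \<tau> \<longrightarrow> 1 * sum g (layer i) < \<tau> * sum g (layer i)"
      using t \<tau> by (auto intro!: mult_right_mono)
    have partners: "B \<in> layer (N + t - i) \<and> B \<notin> layer i"
      if "A \<in> layer i" "B \<in> \<T>" "N \<in> B" "card (A \<inter> B) = t" for A B
    proof -
      have "A \<in> \<T>" "N \<in> A" "card A = i" using that by (auto simp: layer_def \<C>_def)
      then show ?thesis
        using that sizes[of A B] partner[of A B] i(1) by (auto simp: layer_def)
    qed
    have layers: "layer i \<subseteq> \<C>" "layer (N + t - i) \<subseteq> \<C>" by (auto simp: layer_def)
    show ?thesis
    proof (rule exI[of _ "layer i"], rule exI[of _ "layer (N + t - i)"], intro conjI ballI impI)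
      show "sum g (layer (N + t - i)) \<le> \<tau> * sum g (layer i)"
        "real t < \<tau> \<Longrightarrow> sum g (layer (N + t - i)) < \<tau> * sum g (layer i)"
        using i(3) scale by linarith+
    qed (use i(2) layers partners in blast)+
  next
    case False
    then have mid: "2 * card A = N + t" if "A \<in> \<C>" for A using that by blast
    have A0: "A0 \<in> \<C>" using tight partner[of B0 A0] by (simp add: Int_commute)
    \<comment> \<open>The number of points that a set in \<open>\<C>\<close> misses, so that \<open>N = t + 2 * k\<close>.\<close>
    define k where "k = N - card A0"
    have "card A0 \<le> N" using card_mono[of "{1..N}" A0] T(1) tight(1) by simp
    then have k: "N = t + 2 * k" using mid[OF A0] by (simp add: k_def)
    then have k1: "1 \<le> k" using t by (simp add: N_def)
    have miss: "card ({1..n} - A) = k" if A: "A \<in> \<C>" for A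
    proof -
      have NA: "N \<in> A" and AT: "A \<in> \<T>" using A by (auto simp: \<C>_def)
      have "{1..n} - A = {1..N} - A" using NA by (auto simp: N_def le_Suc_eq)
      then have "card ({1..n} - A) = N - card A" using T[OF AT] by (simp add: card_Diff_subset)
      then show ?thesis using mid[OF A] k by simp
    qed
    let ?D = "\<lambda>j. {A \<in> \<C>. j \<notin> A}"
    \<comment> \<open>Averaging over \<open>j\<close>: each set in \<open>\<C>\<close> misses \<open>k\<close> of the \<open>n\<close> points below \<open>N\<close>.\<close>
    have "(\<Sum>j\<in>{1..n}. sum g (?D j)) = (\<Sum>j\<in>{1..n}. \<Sum>A\<in>\<C>. if j \<notin> A then g A else 0)"
      by (intro sum.cong refl sum.inter_filter finC)
    also have "\<dots> = (\<Sum>A\<in>\<C>. \<Sum>j\<in>{1..n}. if j \<notin> A then g A else 0)" by (rule sum.swap)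
    also have "\<dots> = (\<Sum>A\<in>\<C>. real k * g A)"
    proof (rule sum.cong[OF refl])
      fix A assume "A \<in> \<C>"
      have "(\<Sum>j\<in>{1..n}. if j \<notin> A then g A else 0) = (\<Sum>j\<in>{j\<in>{1..n}. j \<notin> A}. g A)"
        by (rule sum.inter_filter[symmetric]) simp
      also have "{j\<in>{1..n}. j \<notin> A} = {1..n} - A" by blast
      finally show "(\<Sum>j\<in>{1..n}. if j \<notin> A then g A else 0) = real k * g A"
        using miss[OF \<open>A \<in> \<C>\<close>] by simp
    qed
    finally have total: "(\<Sum>j\<in>{1..n}. sum g (?D j)) = real k * sum g \<C>"
      by (simp add: sum_distrib_left)
    have "\<exists>j\<in>{1..n}. real k * sum g \<C> \<le> real n * sum g (?D j)"
    proof (rule ccontr)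
      assume "\<not> ?thesis"
      then have "(\<Sum>j\<in>{1..n}. real n * sum g (?D j)) < (\<Sum>j\<in>{1..n}. real k * sum g \<C>)"
        using t by (intro sum_strict_mono) (auto simp: not_le)
      then show False using total by (simp add: sum_distrib_left[symmetric])
    qed
    then obtain j where j: "j \<in> {1..n}" "real k * sum g \<C> \<le> real n * sum g (?D j)" by blast
    define s G where "s = sum g (?D j)" and "G = sum g \<C>"
    have G: "0 < G" unfolding G_def using A0 by (intro sum_pos) auto
    have n: "real n = real t + 2 * real k - 1" using k by (simp add: N_def of_nat_diff)
    have js: "real k * G \<le> real n * s" using j by (simp add: s_def G_def)
    have s: "0 < s"
    proof (rule ccontr)
      assume "\<not> 0 < s"
      then have "real n * s \<le> 0" by (simp add: mult_nonneg_nonpos)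
      moreover have "0 < real k * G" using G k1 by simp
      ultimately show False using js by linarith
    qed
    \<comment> \<open>The fraction \<open>k / n\<close> suffices: \<open>(1 + t) * k - n = (t - 1) * (k - 1)\<close>.\<close>
    have "0 \<le> (real t - 1) * (real k - 1)" using t k1 by simp
    then have nk: "real n \<le> (1 + real t) * real k" unfolding n by (simp add: algebra_simps)
    have "real n * G \<le> (1 + real t) * real k * G" using nk G by simp
    also have "\<dots> \<le> (1 + real t) * (real n * s)" using js by (simp add: mult.assoc mult_left_mono)
    finally have "real n * G \<le> real n * ((1 + real t) * s)" by (simp add: mult_ac)
    then have Gs: "G \<le> (1 + real t) * s" using t by simp
    have "G = s + sum g {A \<in> \<C>. j \<in> A}"
      unfolding G_def s_def using finC
      by (subst sum.union_disjoint[symmetric]) (auto intro!: sum.cong)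
    then have E: "sum g {A \<in> \<C>. j \<in> A} \<le> real t * s" using Gs by (simp add: algebra_simps)
    have "real t * s \<le> \<tau> * s" "real t < \<tau> \<longrightarrow> real t * s < \<tau> * s"
      using \<tau> s by (auto intro: mult_right_mono)
    with E have scale: "sum g {A \<in> \<C>. j \<in> A} \<le> \<tau> * s" "real t < \<tau> \<longrightarrow> sum g {A \<in> \<C>. j \<in> A} < \<tau> * s"
      by auto
    have partners: "B \<in> \<C> \<and> j \<in> B"
      if "A \<in> \<C>" "j \<notin> A" "B \<in> \<T>" "N \<in> B" "card (A \<inter> B) = t" for A B
    proof -
      have A: "A \<in> \<T>" "N \<in> A" using that by (auto simp: \<C>_def)
      have "j \<in> A \<union> B" using cover[of A B] A that j by (simp add: N_def)
      then show ?thesis using partner[of A B] A that by blast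
    qed
    have ne: "?D j \<noteq> {}"
    proof
      assume "?D j = {}"
      then have "s = 0" unfolding s_def by (simp only: sum.empty)
      with s show False by simp
    qed
    show ?thesis
    proof (rule exI[of _ "?D j"], rule exI[of _ "{A \<in> \<C>. j \<in> A}"], intro conjI ballI impI)
      show "sum g {A \<in> \<C>. j \<in> A} \<le> \<tau> * sum g (?D j)"
        "real t < \<tau> \<Longrightarrow> sum g {A \<in> \<C>. j \<in> A} < \<tau> * sum g (?D j)"
        using scale by (simp_all add: s_def)
      show "?D j \<noteq> {}" by (rule ne)
      show "B \<in> {A \<in> \<C>. j \<in> A}" "B \<notin> ?D j"
        if "A \<in> ?D j" "B \<in> \<T>" "N \<in> B" "card (A \<inter> B) = t" for A B
        using partners[of A B] that by auto
    qed auto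
  qed
  then obtain \<D> \<E> where DE: "\<D> \<subseteq> \<C>" "\<E> \<subseteq> \<C>" "\<D> \<noteq> {}"
    and all: "\<forall>A\<in>\<D>. \<forall>B\<in>\<T>. N \<in> B \<longrightarrow> card (A \<inter> B) = t \<longrightarrow> B \<in> \<E> \<and> B \<notin> \<D>"
    and gain: "sum g \<E> \<le> \<tau> * sum g \<D>" "real t < \<tau> \<longrightarrow> sum g \<E> < \<tau> * sum g \<D>"
    by (elim exE conjE) (rule that)
  have tgt: "B \<in> \<E> \<and> B \<notin> \<D>" if "A \<in> \<D>" "B \<in> \<T>" "N \<in> B" "card (A \<inter> B) = t" for A B
    using all that by simp
  define \<D>' where "\<D>' = (\<lambda>A. A - {N}) ` \<D>"
  define \<T>' where "\<T>' = (\<T> - \<E>) \<union> \<D>'"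
  have DN: "N \<in> A" if "A \<in> \<D>" for A using that DE(1) CN by blast
  show ?thesis
  proof (rule that[of \<T>'])
    show "t_intersecting t \<T>'"
      unfolding \<T>'_def \<D>'_def
    proof (rule t_intersecting_exchange)
      show "\<D> \<subseteq> \<T>" using DE(1) CT by (rule order_trans)
    qed (use T(3) int DN tgt in blast)+
    have "A - {N} \<in> bounded_subsets N r" if "A \<in> \<D>" for A
    proof -
      have A: "A \<in> \<T>" using that DE(1) CT by blast
      show ?thesis
        using T[OF A] card_Diff1_le[of A N] by (auto simp: bounded_subsets_def)
    qed
    then show "\<T>' \<subseteq> bounded_subsets N r" using sub unfolding \<T>'_def \<D>'_def by blast
    obtain A where A: "A \<in> \<D>" using DE(3) by blast
    then obtain B where "B \<in> \<T>" "N \<in> B" "card (A \<inter> B) = t" using DE(1) C_partner by blast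
    then have B: "B \<in> \<E>" "B \<in> \<T>" "N \<in> B" using tgt[OF A] by auto
    have D'N: "N \<notin> F" if "F \<in> \<D>'" for F using that by (auto simp: \<D>'_def)
    have "{A \<in> \<T>'. N \<in> A} \<subseteq> {A \<in> \<T>. N \<in> A}" "B \<notin> {A \<in> \<T>'. N \<in> A}"
      using B D'N by (auto simp: \<T>'_def)
    then have "{A \<in> \<T>'. N \<in> A} \<subset> {A \<in> \<T>. N \<in> A}"
      using B by (intro psubsetI) auto
    then show "card {A \<in> \<T>'. N \<in> A} < card {A \<in> \<T>. N \<in> A}"
      using finT by (intro psubset_card_mono) auto
    have inj: "inj_on (\<lambda>A. A - {N}) \<D>"
      by (rule inj_onI) (metis DN insert_Diff)
    have disj: "(\<T> - \<E>) \<inter> \<D>' = {}" using new DE(1) unfolding \<D>'_def by blast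
    have finD: "finite \<D>" by (rule finite_subset[OF DE(1) finC])
    have "sum g \<T>' = sum g (\<T> - \<E>) + sum g \<D>'"
      unfolding \<T>'_def using finT finD disj by (intro sum.union_disjoint) (auto simp: \<D>'_def)
    also have "sum g (\<T> - \<E>) = sum g \<T> - sum g \<E>"
      using DE(2) CT finT by (intro sum_diff) (rule finT, blast)
    also have "sum g \<D>' = (\<Sum>A\<in>\<D>. g (A - {N}))"
      unfolding \<D>'_def by (simp add: sum.reindex[OF inj])
    finally have "sum g \<T>' = sum g \<T> - sum g \<E> + (\<Sum>A\<in>\<D>. g (A - {N}))" .
    moreover have "\<tau> * sum g \<D> \<le> (\<Sum>A\<in>\<D>. g (A - {N}))"
      unfolding sum_distrib_left using ratio DE(1) by (intro sum_mono) blast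
    ultimately show "sum g \<T> \<le> sum g \<T>'" "real t < \<tau> \<Longrightarrow> sum g \<T> < sum g \<T>'"
      using gain by linarith+
  qed
qed

lemma t_intersecting_subset:
  "t_intersecting t \<A> \<Longrightarrow> \<B> \<subseteq> \<A> \<Longrightarrow> t_intersecting t \<B>"
  unfolding t_intersecting_def by (meson subsetD)

text \<open>Forgetting the last point adds the weights of the sets that differ in it only. All three
  conditions survive, which lets the induction on \<open>n\<close> go through.\<close>

lemma decaying_weight_marginal:
  assumes g: "decaying_weight (Suc n) r t \<tau> g"
  shows "decaying_weight n r t \<tau> (\<lambda>A. g A + g (insert (Suc n) A))"
proof -
  let ?N = "Suc n"
  have nonneg: "0 \<le> g A" if "A \<subseteq> {1..?N}" for A
    using g that by (simp add: decaying_weight_def)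
  have pos: "0 < g A" if "A \<subseteq> {1..?N}" "card A \<le> r" for A
    using g that by (simp add: decaying_weight_def)
  have ratio: "\<tau> * g (insert x A) \<le> g A" if "A \<subseteq> {1..?N}" "x \<in> {1..?N}" "x \<notin> A" "t \<le> card A" for A x
    using g that by (simp add: decaying_weight_def)
  have left: "g A \<le> g (insert i (A - {j}))"
    if "A \<subseteq> {1..?N}" "i \<in> {1..?N}" "i \<notin> A" "j \<in> A" "i < j" for A i j
    using g that by (simp add: decaying_weight_def)
  have sub: "A \<subseteq> {1..?N}" "insert ?N A \<subseteq> {1..?N}" "?N \<notin> A" "finite A" if "A \<subseteq> {1..n}" for A
    using that by (auto dest: finite_subset)
  show ?thesis
    unfolding decaying_weight_def
  proof (intro conjI allI impI ballI)
    fix A assume A: "A \<subseteq> {1..n}"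
    show "0 \<le> g A + g (insert ?N A)" using nonneg sub[OF A] by simp
    show "0 < g A + g (insert ?N A)" if "card A \<le> r"
      using pos[OF sub(1)[OF A] that] nonneg[OF sub(2)[OF A]] by simp
    show "\<tau> * (g (insert x A) + g (insert ?N (insert x A))) \<le> g A + g (insert ?N A)"
      if x: "x \<in> {1..n} - A" and c: "t \<le> card A" for x
    proof -
      have "\<tau> * g (insert x A) \<le> g A" using ratio[of A x] x c sub[OF A] by simp
      moreover have "\<tau> * g (insert x (insert ?N A)) \<le> g (insert ?N A)"
        using ratio[of "insert ?N A" x] x c sub[OF A] by simp
      ultimately show ?thesis by (simp add: distrib_left insert_commute)
    qed
    show "g A + g (insert ?N A) \<le> g (insert i (A - {j})) + g (insert ?N (insert i (A - {j})))"
      if ij: "i \<in> {1..n} - A" "j \<in> A" "i < j" for i j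
    proof -
      have "g A \<le> g (insert i (A - {j}))" using left[of A i j] ij sub[OF A] by simp
      moreover have "g (insert ?N A) \<le> g (insert i (insert ?N A - {j}))"
        using left[of "insert ?N A" i j] ij sub[OF A] A by auto
      moreover have "insert i (insert ?N A - {j}) = insert ?N (insert i (A - {j}))"
        using ij A by auto
      ultimately show ?thesis by simp
    qed
  qed
qed

lemma sum_marginal:
  fixes g :: "nat set \<Rightarrow> real"
  assumes "\<S> \<subseteq> Pow {1..n}"
  shows "(\<Sum>A\<in>\<S>. g A + g (insert (Suc n) A)) = sum g (\<S> \<union> insert (Suc n) ` \<S>)"
proof -
  have fin: "finite \<S>" using assms by (rule finite_subset) simp
  have notin: "Suc n \<notin> A" if "A \<in> \<S>" for A using assms that by fastforce
  have inj: "inj_on (insert (Suc n)) \<S>" by (rule inj_onI) (metis notin insert_ident)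
  have "\<S> \<inter> insert (Suc n) ` \<S> = {}" using notin by blast
  then show ?thesis
    using fin by (simp add: sum.union_disjoint sum.reindex[OF inj] sum.distrib)
qed

lemma remove_last_subset: "A - {Suc n} \<subseteq> {1..n}" if "A \<subseteq> {1..Suc n}"
  using that by (auto simp: subset_eq le_Suc_eq)

lemma mem_extensionI:
  assumes "A - {m} \<in> \<S>"
  shows "A \<in> \<S> \<union> insert m ` \<S>"
proof (cases "m \<in> A")
  case True
  then have "insert m (A - {m}) = A" by (rule insert_Diff)
  then show ?thesis using imageI[OF assms, of "insert m"] by simp
next
  case False
  then show ?thesis using assms by simp
qed

lemma supersets_split_last:
  assumes K: "K \<subseteq> {1..n}"
  shows "{A. A \<subseteq> {1..Suc n} \<and> K \<subseteq> A} =
    {A. A \<subseteq> {1..n} \<and> K \<subseteq> A} \<union> insert (Suc n) ` {A. A \<subseteq> {1..n} \<and> K \<subseteq> A}"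
    (is "?L = ?F \<union> insert ?N ` ?F")
proof (rule equalityI; rule subsetI)
  fix A assume A: "A \<in> ?L"
  have "?N \<notin> K" using K by auto
  then have "K \<subseteq> A - {?N}" using A by blast
  moreover have "A - {?N} \<subseteq> {1..n}" using A by (intro remove_last_subset) simp
  ultimately have F: "A - {?N} \<in> ?F" by simp
  then show "A \<in> ?F \<union> insert ?N ` ?F" by (rule mem_extensionI)
next
  fix A assume "A \<in> ?F \<union> insert ?N ` ?F"
  then obtain B where B: "B \<subseteq> {1..n}" "K \<subseteq> B" "A = B \<or> A = insert ?N B" by blast
  have "{1..n} \<subseteq> {1..?N}" "?N \<in> {1..?N}" by auto
  then have "B \<subseteq> {1..?N}" "insert ?N B \<subseteq> {1..?N}" using B(1) by blast+
  then show "A \<in> ?L" using B(2,3) by blast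
qed

text \<open>Induction on \<open>n\<close>. For a fixed ground set, shifts and exchanges are applied until neither is
  possible. Exchanges may increase the sum of the elements and shifts may keep the number of
  members that contain the last point, so the measure is lexicographic: first that number, then the
  total of all elements of all members.\<close>

lemma weighted_t_intersecting:
  fixes g :: "nat set \<Rightarrow> real"
  assumes t: "1 \<le> t" "t \<le> r" and \<tau>: "real t \<le> \<tau>"
  shows "\<lbrakk>t \<le> n; decaying_weight n r t \<tau> g; \<T> \<subseteq> bounded_subsets n r; t_intersecting t \<T>\<rbrakk> \<Longrightarrow>
    sum g \<T> \<le> sum g {A. A \<subseteq> {1..n} \<and> {1..t} \<subseteq> A} \<and>
    (real t < \<tau> \<longrightarrow> sum g \<T> = sum g {A. A \<subseteq> {1..n} \<and> {1..t} \<subseteq> A} \<longrightarrow>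
      (\<exists>T\<subseteq>{1..n}. card T = t \<and> \<T> = star (bounded_subsets n r) T))"
proof (induction n arbitrary: g \<T> rule: dec_induct)
  case base
  have "A = {1..t}" if "A \<in> \<T>" for A
  proof (rule card_subset_eq)
    show "A \<subseteq> {1..t}" using base(2) that by (auto simp: bounded_subsets_def)
    then have "card A \<le> t" using card_mono[of "{1..t}" A] by simp
    moreover have "t \<le> card A" using base(3) that unfolding t_intersecting_def by (metis Int_absorb)
    ultimately show "card A = card {1..t}" by simp
  qed simp
  then have sub: "\<T> \<subseteq> {{1..t}}" by blast
  have all: "{A. A \<subseteq> {1..t} \<and> {1..t} \<subseteq> A} = {{1..t}}" by blast
  have star: "star (bounded_subsets t r) {1..t} = {{1..t}}"
    using t by (auto simp: star_def bounded_subsets_def)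
  have pos: "0 < g {1..t}" using base(1) t by (auto simp: decaying_weight_def)
  from sub consider "\<T> = {}" | "\<T> = {{1..t}}" by blast
  then show ?case
  proof cases
    case 1
    then show ?thesis using pos unfolding all by simp
  next
    case 2
    have "{1..t} \<subseteq> {1..t} \<and> card {1..t} = t \<and> \<T> = star (bounded_subsets t r) {1..t}"
      using 2 star by simp
    then show ?thesis unfolding all 2 by blast
  qed
next
  case (step n)
  let ?N = "Suc n"
  define M where "M = sum g {A. A \<subseteq> {1..?N} \<and> {1..t} \<subseteq> A}"
  \<comment> \<open>Exchanges lower the first component, shifts lower the second one and do not raise the first.\<close>
  define rel where "rel = inv_image (less_than <*lex*> less_than)
    (\<lambda>\<T>. (card {A \<in> \<T>. ?N \<in> A}, \<Sum>A\<in>\<T>. \<Sum>A :: nat))"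
  have g: "decaying_weight ?N r t \<tau> g" by (rule step.prems)
  have "wf rel" by (simp add: rel_def wf_lex_prod)
  then have "\<T> \<subseteq> bounded_subsets ?N r \<Longrightarrow> t_intersecting t \<T> \<Longrightarrow>
      sum g \<T> \<le> M \<and> (real t < \<tau> \<longrightarrow> sum g \<T> = M \<longrightarrow>
      (\<exists>T\<subseteq>{1..?N}. card T = t \<and> \<T> = star (bounded_subsets ?N r) T))" for \<T>
  proof (induction \<T> rule: wf_induct_rule)
    case (less \<T>)
    note sub = less.prems(1) and int = less.prems(2)
    have finT: "finite \<T>" using sub finite_bounded_subsets finite_subset by blast
    have T: "A \<subseteq> {1..?N}" "card A \<le> r" "finite A" if "A \<in> \<T>" for A
      using that sub by (auto simp: bounded_subsets_def dest: finite_subset)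
    consider (shift) i j where "1 \<le> i" "i < j" "j \<le> ?N" "shift i j \<T> \<noteq> \<T>"
      | (exchange) A B where "\<And>i j. \<lbrakk>1 \<le> i; i < j; j \<le> ?N\<rbrakk> \<Longrightarrow> shift i j \<T> = \<T>"
          "A \<in> \<T>" "B \<in> \<T>" "?N \<in> A" "?N \<in> B" "card (A \<inter> B) = t"
      | (delete) "\<And>A B. \<lbrakk>A \<in> \<T>; B \<in> \<T>; ?N \<in> A; ?N \<in> B\<rbrakk> \<Longrightarrow> card (A \<inter> B) \<noteq> t"
    proof (cases "\<exists>i j. 1 \<le> i \<and> i < j \<and> j \<le> ?N \<and> shift i j \<T> \<noteq> \<T>")
      case True
      then show ?thesis using that(1) by blast
    next
      case False
      then have fixed: "shift i j \<T> = \<T>" if "1 \<le> i" "i < j" "j \<le> ?N" for i j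
        using that by blast
      show ?thesis
      proof (cases "\<exists>A\<in>\<T>. \<exists>B\<in>\<T>. ?N \<in> A \<and> ?N \<in> B \<and> card (A \<inter> B) = t")
        case True
        then obtain A B where AB: "A \<in> \<T>" "B \<in> \<T>" "?N \<in> A" "?N \<in> B" "card (A \<inter> B) = t" by blast
        show ?thesis by (rule that(2)[OF fixed AB])
      next
        case False
        then show ?thesis by (intro that(3)) blast
      qed
    qed
    then show ?case
    proof cases
      case shift
      let ?S = "shift i j \<T>"
      have host: "insert i (A - {j}) \<in> bounded_subsets ?N r"
        if "A \<in> bounded_subsets ?N r" "j \<in> A" "i \<notin> A" for A
      proof -
        have "A \<subseteq> {1..?N}" "card A \<le> r" "finite A"
          using that by (auto simp: bounded_subsets_def dest: finite_subset)
        moreover have "card (insert i (A - {j})) = card A"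
          by (rule card_swap[OF \<open>finite A\<close> that(2,3)])
        ultimately show ?thesis using shift(1-3) by (auto simp: bounded_subsets_def)
      qed
      have Ssub: "?S \<subseteq> bounded_subsets ?N r"
        using sub host by (auto simp: shift_def shift_map_def moved_def)
      have Sint: "t_intersecting t ?S"
        by (rule t_intersecting_shift) (use T(3) int shift(2) in simp_all)
      have "card {A \<in> ?S. ?N \<in> A} \<le> card {A \<in> \<T>. ?N \<in> A}"
      proof (rule surj_card_le)
        show "{A \<in> ?S. ?N \<in> A} \<subseteq> shift_map i j \<T> ` {A \<in> \<T>. ?N \<in> A}"
        proof
          fix B assume "B \<in> {A \<in> ?S. ?N \<in> A}"
          then obtain A where A: "A \<in> \<T>" "B = shift_map i j \<T> A" "?N \<in> shift_map i j \<T> A"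
            by (auto simp: shift_def)
          have "?N \<in> A"
            using A(3) shift(2,3) unfolding shift_map_def by (simp split: if_split_asm)
          then show "B \<in> shift_map i j \<T> ` {A \<in> \<T>. ?N \<in> A}" using A(1,2) by simp
        qed
      qed (use finT in simp)
      moreover have "(\<Sum>A\<in>?S. \<Sum>A) < (\<Sum>A\<in>\<T>. \<Sum>A)"
        by (rule shift_decreases) (use finT T(3) shift(2,4) in simp_all)
      ultimately have "(?S, \<T>) \<in> rel" by (auto simp: rel_def)
      from less.IH[OF this Ssub Sint]
      have IH: "sum g ?S \<le> M" "real t < \<tau> \<Longrightarrow> sum g ?S = M \<Longrightarrow>
        \<exists>T\<subseteq>{1..?N}. card T = t \<and> ?S = star (bounded_subsets ?N r) T" by auto
      have le: "sum g \<T> \<le> sum g ?S"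
      proof (rule sum_shift_mono)
        fix A assume "A \<in> \<T>" "j \<in> A" "i \<notin> A"
        then show "g A \<le> g (insert i (A - {j}))"
          using g T(1)[of A] shift(1-3) by (simp add: decaying_weight_def)
      qed
      show ?thesis
      proof (intro conjI impI)
        show "sum g \<T> \<le> M" using le IH by simp
        assume "real t < \<tau>" "sum g \<T> = M"
        then obtain T where T': "T \<subseteq> {1..?N}" "card T = t" "?S = star (bounded_subsets ?N r) T"
          using IH(2) order_antisym[OF IH(1)] le by auto
        have TB: "T \<in> bounded_subsets ?N r" using T' t by (simp add: bounded_subsets_def)
        have finT': "finite T" using T' finite_subset by blast
        have "\<T> = star (bounded_subsets ?N r) T \<or>
          i \<in> T \<and> j \<notin> T \<and> \<T> = star (bounded_subsets ?N r) (insert j (T - {i}))"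
        proof (rule unshift_star[OF sub int finT' T'(2) _ T'(3) host])
          \<comment> \<open>The core itself is a member of the star and separates all pairs.\<close>
          show "\<exists>Z\<in>bounded_subsets ?N r. T \<subseteq> Z \<and> j \<notin> Z \<and> Z \<inter> X = T \<and> Z \<inter> Y = T"
            if "j \<notin> T" "T \<subseteq> X" "T \<subseteq> Y" for X Y
            using TB that by blast
        qed (use shift(2) in simp)
        moreover have "insert j (T - {i}) \<subseteq> {1..?N}" using T'(1) shift(1-3) by auto
        moreover have "card (insert j (T - {i})) = t" if "i \<in> T" "j \<notin> T"
          using card_swap[OF finT' that] T' by simp
        ultimately show "\<exists>T\<subseteq>{1..?N}. card T = t \<and> \<T> = star (bounded_subsets ?N r) T"
          using T'(1,2) by metis
      qed
    next
      case exchange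
      obtain \<T>' where new: "\<T>' \<subseteq> bounded_subsets ?N r" "t_intersecting t \<T>'"
        "card {A \<in> \<T>'. ?N \<in> A} < card {A \<in> \<T>. ?N \<in> A}"
        "sum g \<T> \<le> sum g \<T>'" "real t < \<tau> \<Longrightarrow> sum g \<T> < sum g \<T>'"
        using exchange_increases_weight[OF t(1) step.hyps(1) \<tau> g sub int exchange] by blast
      have "(\<T>', \<T>) \<in> rel" using new(3) by (simp add: rel_def)
      from less.IH[OF this new(1,2)] have "sum g \<T>' \<le> M" by (rule conjunct1)
      then show ?thesis using new(4,5) by auto
    next
      case delete
      define \<S> where "\<S> = (\<lambda>A. A - {?N}) ` \<T>"
      let ?g = "\<lambda>A. g A + g (insert ?N A)"
      have Ssub: "\<S> \<subseteq> bounded_subsets n r"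
      proof
        fix S assume "S \<in> \<S>"
        then obtain A where A: "A \<in> \<T>" "S = A - {?N}" by (auto simp: \<S>_def)
        then have "card S \<le> r" using T(2)[OF A(1)] card_Diff1_le[of A ?N] by simp
        moreover have "S \<subseteq> {1..n}" using remove_last_subset[OF T(1)[OF A(1)]] A(2) by simp
        ultimately show "S \<in> bounded_subsets n r" by (simp add: bounded_subsets_def)
      qed
      have Sint: "t_intersecting t \<S>"
      proof -
        have "t_intersecting t ((\<T> - {}) \<union> (\<lambda>A. A - {?N}) ` {A \<in> \<T>. ?N \<in> A})"
          by (rule t_intersecting_exchange) (use T(3) int delete in auto)
        moreover have "\<S> \<subseteq> (\<T> - {}) \<union> (\<lambda>A. A - {?N}) ` {A \<in> \<T>. ?N \<in> A}"
        proof
          fix S assume "S \<in> \<S>"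
          then obtain A where A: "A \<in> \<T>" "S = A - {?N}" unfolding \<S>_def by blast
          then show "S \<in> (\<T> - {}) \<union> (\<lambda>A. A - {?N}) ` {A \<in> \<T>. ?N \<in> A}"
            by (cases "?N \<in> A") auto
        qed
        ultimately show ?thesis by (rule t_intersecting_subset)
      qed
      have SPow: "\<S> \<subseteq> Pow {1..n}" using Ssub by (auto simp: bounded_subsets_def)
      have M: "sum ?g {A. A \<subseteq> {1..n} \<and> {1..t} \<subseteq> A} = M"
      proof -
        have sub: "{1..t} \<subseteq> {1..n}" using step.hyps(1) by simp
        show ?thesis unfolding M_def supersets_split_last[OF sub] by (intro sum_marginal) blast
      qed
      from step.IH[OF decaying_weight_marginal[OF g] Ssub Sint]
      have IH: "sum ?g \<S> \<le> M" "real t < \<tau> \<Longrightarrow> sum ?g \<S> = M \<Longrightarrow>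
        \<exists>T\<subseteq>{1..n}. card T = t \<and> \<S> = star (bounded_subsets n r) T"
        unfolding M by auto
      have lift: "sum ?g \<S> = sum g (\<S> \<union> insert ?N ` \<S>)" by (rule sum_marginal[OF SPow])
      have "\<T> \<subseteq> \<S> \<union> insert ?N ` \<S>"
      proof
        fix A assume A: "A \<in> \<T>"
        then have "A - {?N} \<in> \<S>" by (simp add: \<S>_def)
        then show "A \<in> \<S> \<union> insert ?N ` \<S>" by (rule mem_extensionI)
      qed
      moreover have fin': "finite (\<S> \<union> insert ?N ` \<S>)" using finT by (simp add: \<S>_def)
      moreover have nonneg: "0 \<le> g A" if A: "A \<in> \<S> \<union> insert ?N ` \<S>" for A
      proof -
        from A obtain B where B: "B \<in> \<S>" "A = B \<or> A = insert ?N B" by blast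
        then have "B \<subseteq> {1..n}" using SPow by blast
        moreover have "{1..n} \<subseteq> {1..?N}" "?N \<in> {1..?N}" by auto
        ultimately have "A \<subseteq> {1..?N}" using B(2) by blast
        then show ?thesis using g unfolding decaying_weight_def by blast
      qed
      ultimately have le: "sum g \<T> \<le> sum ?g \<S>"
        unfolding lift by (intro sum_mono2) auto
      show ?thesis
      proof (intro conjI impI)
        show "sum g \<T> \<le> M" using le IH by simp
        assume "real t < \<tau>" and eq: "sum g \<T> = M"
        then obtain K where K: "K \<subseteq> {1..n}" "card K = t" "\<S> = star (bounded_subsets n r) K"
          using IH(2) order_antisym[OF IH(1)] le by auto
        let ?star = "star (bounded_subsets ?N r) K"
        have Tsub: "\<T> \<subseteq> ?star"
        proof
          fix A assume A: "A \<in> \<T>"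
          then have "A - {?N} \<in> \<S>" by (simp add: \<S>_def)
          then show "A \<in> ?star" using A sub unfolding K(3) by (auto simp: star_def)
        qed
        have "?star \<subseteq> \<S> \<union> insert ?N ` \<S>"
        proof
          fix A assume A: "A \<in> ?star"
          then have "K \<subseteq> A" "card A \<le> r" "A \<subseteq> {1..?N}" by (auto simp: star_def bounded_subsets_def)
          moreover have "?N \<notin> K" using K(1) by auto
          then have "K \<subseteq> A - {?N}" using \<open>K \<subseteq> A\<close> by blast
          moreover have "A - {?N} \<subseteq> {1..n}" using \<open>A \<subseteq> {1..?N}\<close> by (rule remove_last_subset)
          moreover have "card (A - {?N}) \<le> card A" by (rule card_Diff1_le)
          ultimately have "A - {?N} \<in> \<S>" unfolding K(3) by (auto simp: star_def bounded_subsets_def)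
          then show "A \<in> \<S> \<union> insert ?N ` \<S>" by (rule mem_extensionI)
        qed
        then have starle: "sum g ?star \<le> M"
          using IH(1) lift sum_mono2[OF fin', of ?star g] nonneg by fastforce
        \<comment> \<open>Positive weights leave no room between \<open>\<T>\<close> and the star that contains it.\<close>
        have "\<T> = ?star"
        proof (rule ccontr)
          assume "\<T> \<noteq> ?star"
          then obtain F where F: "F \<in> ?star" "F \<notin> \<T>" using Tsub by blast
          have fins: "finite ?star" by (simp add: star_def finite_bounded_subsets)
          have "sum g \<T> < sum g ?star"
          proof (rule sum_strict_mono2[OF fins Tsub])
            show "F \<in> ?star - \<T>" using F by simp
          qed (use F g in \<open>auto simp: star_def bounded_subsets_def decaying_weight_def\<close>)
          then show False using starle eq by simp
        qed
        moreover have "K \<subseteq> {1..?N}" using K(1) by auto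
        ultimately show "\<exists>T\<subseteq>{1..?N}. card T = t \<and> \<T> = star (bounded_subsets ?N r) T"
          using K(2) by metis
      qed
    qed
  qed
  then show ?case unfolding M_def using step.prems by blast
qed

section \<open>Signed sets and their traces\<close>

definition ones :: "(nat \<times> nat) set \<Rightarrow> nat set" where
  "ones A = {x. (x, 1) \<in> A}"

lemma inj_on_fstD: "inj_on fst A \<Longrightarrow> (x, y) \<in> A \<Longrightarrow> (x, z) \<in> A \<Longrightarrow> y = z"
  using inj_onD[of fst A "(x, y)" "(x, z)"] by simp

lemma signed_sets_iff:
  "A \<in> signed_sets n c r \<longleftrightarrow>
    finite A \<and> card A = r \<and> inj_on fst A \<and> fst ` A \<subseteq> {1..n} \<and> (\<forall>(x, y)\<in>A. y \<in> {1..c x})"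
    (is "?L \<longleftrightarrow> ?R")
proof
  assume ?L
  then obtain X y where X: "X \<subseteq> {1..n}" "finite X" "card X = r" and y: "\<And>x. x \<in> X \<Longrightarrow> y x \<in> {1..c x}"
    and A: "A = (\<lambda>x. (x, y x)) ` X"
    unfolding signed_sets_def nsets_def by blast
  have "inj_on (\<lambda>x. (x, y x)) X" by (rule inj_onI) simp
  then have "card A = r" using X A by (simp add: card_image)
  moreover have "inj_on fst A" unfolding A by (rule inj_onI) auto
  moreover have "fst ` A = X" unfolding A by force
  ultimately show ?R using X y unfolding A by auto
next
  assume R: ?R
  define y where "y x = (THE y. (x, y) \<in> A)" for x
  have y: "y x = z" if "(x, z) \<in> A" for x z
    unfolding y_def using that inj_on_fstD[of A] R by (intro the_equality) auto
  have "A = (\<lambda>x. (x, y x)) ` fst ` A"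
    using y by (force simp: image_iff)
  moreover have "fst ` A \<in> nsets {1..n} r"
    using R by (simp add: nsets_def card_image)
  moreover have "\<forall>x\<in>fst ` A. y x \<in> {1..c x}"
    using R y by fastforce
  ultimately show ?L unfolding signed_sets_def by blast
qed

lemma signed_setsD:
  assumes "A \<in> signed_sets n c r"
  shows "finite A" "card A = r" "(x, y) \<in> A \<Longrightarrow> x \<in> {1..n}" "(x, y) \<in> A \<Longrightarrow> y \<in> {1..c x}"
    "(x, y) \<in> A \<Longrightarrow> (x, z) \<in> A \<Longrightarrow> y = z"
  using assms inj_on_fstD[of A x y z] unfolding signed_sets_iff by auto

lemma finite_signed_sets: "finite (signed_sets n c r)"
proof (rule finite_subset)
  show "signed_sets n c r \<subseteq> Pow (SIGMA x:{1..n}. {1..c x})"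
    using signed_setsD(3,4) by (intro subsetI PowI) (clarify; blast)
qed simp

lemma relabel_signed_set:
  assumes A: "A \<in> signed_sets n c r" and w: "\<And>x y. (x, y) \<in> A \<Longrightarrow> w x y \<in> {1..c x}"
  shows "(\<lambda>(x, y). (x, w x y)) ` A \<in> signed_sets n c r"
proof -
  let ?h = "\<lambda>(x, y). (x, w x y)"
  have "inj_on ?h A" by (rule inj_onI) (use signed_setsD(5)[OF A] in auto)
  then have "card (?h ` A) = r" using signed_setsD(2)[OF A] by (simp add: card_image)
  moreover have "inj_on fst (?h ` A)"
    by (rule inj_onI, clarsimp) (metis signed_setsD(5)[OF A])
  moreover have "fst ` ?h ` A \<subseteq> {1..n}" using signed_setsD(3)[OF A] by auto
  ultimately show ?thesis
    unfolding signed_sets_iff using signed_setsD(1)[OF A] w by auto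
qed

lemma replace_value:
  assumes A: "A \<in> signed_sets n c r" and xy: "(x, y) \<in> A" and z: "z \<in> {1..c x}"
  shows "insert (x, z) (A - {(x, y)}) \<in> signed_sets n c r"
proof -
  let ?w = "\<lambda>a b. if a = x then z else b"
  have "insert (x, z) (A - {(x, y)}) = (\<lambda>(a, b). (a, ?w a b)) ` A"
  proof (rule set_eqI, clarify)
    fix a b
    have "b = y" if "(x, b) \<in> A" using signed_setsD(5)[OF A that xy] .
    then show "(a, b) \<in> insert (x, z) (A - {(x, y)}) \<longleftrightarrow> (a, b) \<in> (\<lambda>(a, b). (a, ?w a b)) ` A"
      using xy by (cases "a = x") (force simp: image_iff)+
  qed
  moreover have "?w a b \<in> {1..c a}" if "(a, b) \<in> A" for a b
    using z signed_setsD(4)[OF A that] by simp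
  ultimately show ?thesis using relabel_signed_set[OF A] by presburger
qed

lemma ones_image: "(\<lambda>x. (x, 1)) ` ones A \<subseteq> A"
  by (auto simp: ones_def)

lemma ones_bounded:
  assumes A: "A \<in> signed_sets n c r"
  shows "ones A \<in> bounded_subsets n r"
proof -
  have "card (ones A) = card ((\<lambda>x. (x, 1 :: nat)) ` ones A)"
    by (simp add: card_image inj_on_def)
  also have "\<dots> \<le> card A" by (rule card_mono[OF signed_setsD(1)[OF A] ones_image])
  finally have "card (ones A) \<le> r" using signed_setsD(2)[OF A] by simp
  moreover have "ones A \<subseteq> {1..n}"
    unfolding ones_def using signed_setsD(3)[OF A] by blast
  ultimately show ?thesis by (simp add: bounded_subsets_def)
qed

definition trace_count :: "nat \<Rightarrow> (nat \<Rightarrow> nat) \<Rightarrow> nat \<Rightarrow> nat set \<Rightarrow> real" where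
  "trace_count n c r T = real (card {A \<in> signed_sets n c r. ones A = T})"

lemma trace_count_pos:
  assumes T: "T \<subseteq> {1..n}" "card T \<le> r" and rn: "r \<le> n" and c: "\<And>x. x \<in> {1..n} \<Longrightarrow> 2 \<le> c x"
  shows "0 < trace_count n c r T"
proof -
  obtain X where X: "T \<subseteq> X" "X \<subseteq> {1..n}" "card X = r"
    using exists_subset_between[of T r "{1..n}"] T rn by auto
  let ?y = "\<lambda>x. if x \<in> T then 1 else 2"
  let ?A = "(\<lambda>x. (x, ?y x)) ` X"
  have "finite X" using X(2) by (rule finite_subset) simp
  then have "X \<in> nsets {1..n} r" using X by (simp add: nsets_def)
  moreover have "?y x \<in> {1..c x}" if "x \<in> X" for x using c[of x] X(2) that by auto
  ultimately have "?A \<in> signed_sets n c r"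
    unfolding signed_sets_def mem_Collect_eq
    by (intro exI[of _ X], intro exI[of _ ?y]) blast
  moreover have "ones ?A = T" using X(1) by (auto simp: ones_def split: if_splits)
  ultimately have "{A \<in> signed_sets n c r. ones A = T} \<noteq> {}" by blast
  then show ?thesis
    unfolding trace_count_def using finite_signed_sets by (simp add: card_gt_0_iff)
qed

text \<open>In a signed set with \<open>(x, 1)\<close>, the value 1 at \<open>x\<close> can be changed to any of the \<open>c x - 1\<close> other
  values, and the original set can be recovered from the result.\<close>

lemma trace_count_ratio:
  assumes x: "x \<notin> T"
  shows "real (c x - 1) * trace_count n c r (insert x T) \<le> trace_count n c r T"
proof -
  let ?B = "{A \<in> signed_sets n c r. ones A = insert x T}"
  let ?B' = "{A \<in> signed_sets n c r. ones A = T}"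
  let ?f = "\<lambda>(A, y). insert (x, y) (A - {(x, 1)})"
  have one: "(x, 1) \<in> A" if "A \<in> ?B" for A using that by (auto simp: ones_def)
  have only: "(x, z) \<in> A \<Longrightarrow> z = 1" if "A \<in> ?B" for A z
    using signed_setsD(5)[of A n c r x z 1] one[OF that] that by blast
  have recover: "A = insert (x, 1) (?f (A, y) - {(x, y)})" if "A \<in> ?B" "y \<noteq> 1" for A y
  proof -
    have "(x, y) \<notin> A" using only[OF that(1)] that(2) by blast
    then show ?thesis using one[OF that(1)] by auto
  qed
  have "inj_on ?f (?B \<times> {2..c x})"
  proof (rule inj_onI, clarify)
    fix A y A' y'
    assume A: "A \<in> signed_sets n c r" "ones A = insert x T"
      and A': "A' \<in> signed_sets n c r" "ones A' = insert x T"
      and y: "y \<in> {2..c x}" "y' \<in> {2..c x}"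
      and eq: "insert (x, y) (A - {(x, 1)}) = insert (x, y') (A' - {(x, 1)})"
    have AB: "A \<in> ?B" "A' \<in> ?B" using A A' by auto
    have "(x, y) \<in> insert (x, y') (A' - {(x, 1)})" unfolding eq[symmetric] by simp
    then have yy: "y = y'" using only[OF AB(2)] by auto
    moreover have "A = A'"
    proof -
      have "y \<noteq> 1" using y by auto
      have "A = insert (x, 1) (?f (A, y) - {(x, y)})" by (rule recover[OF AB(1) \<open>y \<noteq> 1\<close>])
      also have "?f (A, y) = ?f (A', y)" using eq yy by simp
      also have "insert (x, 1) (\<dots> - {(x, y)}) = A'" by (rule recover[OF AB(2) \<open>y \<noteq> 1\<close>, symmetric])
      finally show ?thesis .
    qed
    ultimately show "A = A' \<and> y = y'" by simp
  qed
  moreover have "?f ` (?B \<times> {2..c x}) \<subseteq> ?B'"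
  proof (rule subsetI, elim imageE, clarify)
    fix A y assume A: "A \<in> signed_sets n c r" "ones A = insert x T" and y: "y \<in> {2..c x}"
    have AB: "A \<in> ?B" using A by auto
    have "insert (x, y) (A - {(x, 1)}) \<in> signed_sets n c r"
      by (rule replace_value[OF A(1) one[OF AB]]) (use y in auto)
    moreover have "ones (insert (x, y) (A - {(x, 1)})) = ones A - {x}"
      using y by (auto simp: ones_def)
    ultimately show "insert (x, y) (A - {(x, 1)}) \<in> signed_sets n c r \<and>
        ones (insert (x, y) (A - {(x, 1)})) = T"
      using A(2) x by simp
  qed
  moreover have "finite ?B'" using finite_signed_sets by simp
  ultimately have "card (?B \<times> {2..c x}) \<le> card ?B'" by (rule card_inj_on_le)
  then have "(c x - 1) * card ?B \<le> card ?B'" by (simp add: card_cartesian_product mult.commute)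
  then have "real ((c x - 1) * card ?B) \<le> real (card ?B')" by (rule of_nat_mono)
  then show ?thesis unfolding trace_count_def of_nat_mult .
qed

text \<open>Interchanging the coordinates \<open>i\<close> and \<open>j\<close> maps the signed sets with trace \<open>T\<close> injectively
  to those with the shifted trace. The result is a signed set because the value at \<open>j\<close> is 1 and
  the value at \<open>i\<close>, if there is one, is at most \<open>c i \<le> c j\<close>.\<close>

lemma trace_count_shift:
  assumes ij: "i \<in> {1..n}" "j \<in> {1..n}" "i \<notin> T" "j \<in> T" "0 < c i" "c i \<le> c j"
  shows "trace_count n c r T \<le> trace_count n c r (insert i (T - {j}))"
proof -
  let ?s = "transpose i j"
  let ?f = "\<lambda>(x, y :: nat). (?s x, y)"
  let ?B = "{A \<in> signed_sets n c r. ones A = T}"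
  let ?B' = "{A \<in> signed_sets n c r. ones A = insert i (T - {j})}"
  have inv: "?f (?f p) = p" for p by (cases p) simp
  have f: "inj ?f" by (rule inj_on_inverseI[where g = ?f]) (rule inv)
  have "?f ` A \<in> ?B'" if A: "A \<in> ?B" for A
  proof -
    have AS: "A \<in> signed_sets n c r" using A by simp
    have j1: "(j, 1) \<in> A" using A ij by (auto simp: ones_def)
    have val: "y \<in> {1..c (?s x)}" if "(x, y) \<in> A" for x y
    proof -
      have "y = 1" if "x = j" using signed_setsD(5)[OF AS, of j y 1] j1 that \<open>(x, y) \<in> A\<close> by blast
      then show ?thesis
        using signed_setsD(4)[OF AS that] ij by (auto simp: transpose_def)
    qed
    have "card (?f ` A) = r"
      using signed_setsD(2)[OF AS] inj_on_subset[OF f] by (simp add: card_image)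
    moreover have "inj_on fst (?f ` A)"
    proof (rule inj_onI, elim imageE, clarify)
      fix a b a' b' assume "(a, b) \<in> A" "(a', b') \<in> A" "fst (?s a, b) = fst (?s a', b')"
      then have "?s a = ?s a'" by simp
      then have "a = a'" by (metis transpose_involutory)
      then show "?s a = ?s a' \<and> b = b'"
        using signed_setsD(5)[OF AS] \<open>(a, b) \<in> A\<close> \<open>(a', b') \<in> A\<close> by blast
    qed
    moreover have "fst ` ?f ` A \<subseteq> {1..n}"
    proof (rule subsetI, elim imageE, clarify)
      fix a b assume "(a, b) \<in> A"
      then have "a \<in> {1..n}" by (rule signed_setsD(3)[OF AS])
      then show "fst (?s a, b) \<in> {1..n}" using ij by (simp add: transpose_def)
    qed
    moreover have "\<forall>(x, y)\<in>?f ` A. y \<in> {1..c x}" using val by auto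
    ultimately have "?f ` A \<in> signed_sets n c r"
      unfolding signed_sets_iff using signed_setsD(1)[OF AS] by blast
    moreover have "ones (?f ` A) = insert i (T - {j})"
    proof (rule set_eqI)
      fix x
      have "x \<in> ones (?f ` A) \<longleftrightarrow> ?s x \<in> ones A"
        unfolding ones_def by (force simp: image_iff)
      also have "\<dots> \<longleftrightarrow> x \<in> insert i (T - {j})"
        using A ij by (auto simp: transpose_def)
      finally show "x \<in> ones (?f ` A) \<longleftrightarrow> x \<in> insert i (T - {j})" .
    qed
    ultimately show ?thesis by simp
  qed
  then have "image ?f ` ?B \<subseteq> ?B'" by blast
  moreover have "inj_on (image ?f) ?B" using f by (rule inj_on_image[OF inj_on_subset]) simp
  moreover have "finite ?B'" using finite_signed_sets by simp
  ultimately have "card ?B \<le> card ?B'" by (intro card_inj_on_le)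
  then show ?thesis by (simp add: trace_count_def)
qed

lemma decaying_weight_trace_count:
  assumes IP: "IP_sequence n c" and rn: "r \<le> n" and \<tau>: "1 \<le> \<tau>" "\<tau> \<le> real (c 1) - 1"
  shows "decaying_weight n r t \<tau> (trace_count n c r)"
proof -
  have c1: "c 1 \<le> c x" if "x \<in> {1..n}" for x
  proof -
    have "1 \<in> {1..n}" "1 \<le> x" using that by auto
    then show ?thesis using IP that unfolding IP_sequence_def by blast
  qed
  have two: "2 \<le> c x" if "x \<in> {1..n}" for x using c1[OF that] \<tau> by linarith
  show ?thesis
    unfolding decaying_weight_def
  proof (intro conjI allI impI ballI)
    fix A assume A: "A \<subseteq> {1..n}"
    show "0 \<le> trace_count n c r A" by (simp add: trace_count_def)
    show "0 < trace_count n c r A" if "card A \<le> r" by (rule trace_count_pos[OF A that rn two])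
    show "\<tau> * trace_count n c r (insert x A) \<le> trace_count n c r A" if x: "x \<in> {1..n} - A" for x
    proof -
      have "real (c 1) \<le> real (c x)" using c1[of x] x by simp
      then have "\<tau> \<le> real (c x - 1)" using \<tau> two[of x] x by (simp add: of_nat_diff)
      then have "\<tau> * trace_count n c r (insert x A) \<le> real (c x - 1) * trace_count n c r (insert x A)"
        by (intro mult_right_mono) (simp_all add: trace_count_def)
      also have "\<dots> \<le> trace_count n c r A" by (rule trace_count_ratio) (use x in simp)
      finally show ?thesis .
    qed
    show "trace_count n c r A \<le> trace_count n c r (insert i (A - {j}))"
      if ij: "i \<in> {1..n} - A" "j \<in> A" "i < j" for i j
    proof (rule trace_count_shift)
      show j: "j \<in> {1..n}" using A ij by blast
      show "0 < c i" "c i \<le> c j" using IP ij j by (auto simp: IP_sequence_def)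
    qed (use ij in simp_all)
  qed
qed

section \<open>Reduction to traces\<close>

text \<open>In one of the two sets, a common pair \<open>(x, y)\<close> with \<open>y \<noteq> 1\<close> can be replaced by \<open>(x, 1)\<close> within
  the family. The other set does not contain \<open>(x, 1)\<close>, so the common ones stay the same while the
  other common pairs become fewer. When none is left, the whole intersection consists of ones.\<close>

lemma t_intersecting_ones:
  assumes sub: "\<A> \<subseteq> signed_sets n c r" and int: "t_intersecting t \<A>"
    and shifted: "\<And>x y. \<lbrakk>x \<in> {1..n}; y \<in> {2..c x}\<rbrakk> \<Longrightarrow> shift (x, 1) (x, y) \<A> = \<A>"
  shows "t_intersecting t (ones ` \<A>)"
proof -
  have "t \<le> card (ones A \<inter> ones B)" if "A \<in> \<A>" "B \<in> \<A>" for A B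
    using that(1)
  proof (induction "card {q \<in> A \<inter> B. snd q \<noteq> 1}" arbitrary: A rule: less_induct)
    case (less A)
    have AS: "A \<in> signed_sets n c r" and BS: "B \<in> signed_sets n c r" using less.prems that sub by auto
    have fin: "finite (A \<inter> B)" using signed_setsD(1)[OF AS] by simp
    show ?case
    proof (cases "{q \<in> A \<inter> B. snd q \<noteq> 1} = {}")
      case True
      have "A \<inter> B \<subseteq> (\<lambda>x. (x, 1)) ` (ones A \<inter> ones B)"
      proof
        fix q assume q: "q \<in> A \<inter> B"
        then have "snd q = 1" using True by blast
        then have "q = (fst q, 1)" by (metis prod.collapse)
        moreover from this have "fst q \<in> ones A \<inter> ones B" using q unfolding ones_def by (metis IntD1 IntD2 IntI mem_Collect_eq)
        ultimately show "q \<in> (\<lambda>x. (x, 1)) ` (ones A \<inter> ones B)" by (rule image_eqI)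
      qed
      moreover have "finite (ones A \<inter> ones B)"
        using ones_bounded[OF AS] by (auto simp: bounded_subsets_def dest: finite_subset)
      ultimately have "card (A \<inter> B) \<le> card (ones A \<inter> ones B)" by (intro surj_card_le)
      moreover have "t \<le> card (A \<inter> B)" using int less.prems that(2) by (auto simp: t_intersecting_def)
      ultimately show ?thesis by simp
    next
      case False
      then obtain x y where xy: "(x, y) \<in> A" "(x, y) \<in> B" "y \<noteq> 1" by auto
      let ?A' = "insert (x, 1) (A - {(x, y)})"
      have notin: "(x, 1) \<notin> A" "(x, 1) \<notin> B"
        using signed_setsD(5)[OF AS, of x y 1] signed_setsD(5)[OF BS, of x y 1] xy by auto
      have "x \<in> {1..n}" "y \<in> {2..c x}"
        using signed_setsD(3,4)[OF AS xy(1)] xy(3) by auto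
      from shift_fixedD[OF shifted[OF this] less.prems xy(1) notin(1)]
      have A': "?A' \<in> \<A>" .
      have "{q \<in> ?A' \<inter> B. snd q \<noteq> 1} \<subseteq> {q \<in> A \<inter> B. snd q \<noteq> 1}" by auto
      moreover have "(x, y) \<in> {q \<in> A \<inter> B. snd q \<noteq> 1} - {q \<in> ?A' \<inter> B. snd q \<noteq> 1}"
        using xy by simp
      ultimately have "{q \<in> ?A' \<inter> B. snd q \<noteq> 1} \<subset> {q \<in> A \<inter> B. snd q \<noteq> 1}" by blast
      then have "card {q \<in> ?A' \<inter> B. snd q \<noteq> 1} < card {q \<in> A \<inter> B. snd q \<noteq> 1}"
        by (rule psubset_card_mono[rotated]) (rule finite_subset[OF _ fin], auto)
      from less.hyps[OF this A'] have "t \<le> card (ones ?A' \<inter> ones B)" .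
      also have "ones ?A' \<inter> ones B = ones A \<inter> ones B"
        using xy(3) notin by (auto simp: ones_def)
      finally show ?thesis .
    qed
  qed
  then show ?thesis by (auto simp: t_intersecting_def)
qed

lemma sum_trace_count:
  assumes "finite \<T>"
  shows "sum (trace_count n c r) \<T> = real (card {A \<in> signed_sets n c r. ones A \<in> \<T>})"
proof -
  let ?F = "{A \<in> signed_sets n c r. ones A \<in> \<T>}"
  have "(\<Sum>T\<in>\<T>. \<Sum>A\<in>{A \<in> ?F. ones A = T}. 1 :: real) = (\<Sum>A\<in>?F. 1)"
    by (rule sum.group) (use assms finite_signed_sets in auto)
  moreover have "(\<Sum>A\<in>{A \<in> ?F. ones A = T}. 1 :: real) = trace_count n c r T" if "T \<in> \<T>" for T
  proof -
    have "{A \<in> ?F. ones A = T} = {A \<in> signed_sets n c r. ones A = T}" using that by blast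
    then show ?thesis by (simp add: trace_count_def)
  qed
  ultimately show ?thesis by simp
qed

lemma signed_set_ones:
  assumes "T \<subseteq> {1..n}" "card T = t" "\<And>x. x \<in> {1..n} \<Longrightarrow> 0 < c x"
  shows "(\<lambda>x. (x, 1)) ` T \<in> signed_sets n c t"
proof -
  have "finite T" using assms(1) by (rule finite_subset) simp
  then have "T \<in> nsets {1..n} t" using assms by (simp add: nsets_def)
  moreover have "\<forall>x\<in>T. 1 \<in> {1..c x}" using assms(1,3) by (auto simp: Suc_le_eq)
  ultimately show ?thesis
    unfolding signed_sets_def mem_Collect_eq
    by (intro exI[of _ T], intro exI[of _ "\<lambda>x. 1"]) blast
qed

lemma signed_sets_fix_eq:
  "signed_sets_fix n c r t = {A \<in> signed_sets n c r. ones A \<in> {T. T \<subseteq> {1..n} \<and> {1..t} \<subseteq> T}}"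
proof -
  have "ones A \<subseteq> {1..n}" if "A \<in> signed_sets n c r" for A
    using ones_bounded[OF that] by (simp add: bounded_subsets_def)
  then show ?thesis unfolding signed_sets_fix_def by (auto simp: ones_def subset_eq)
qed

text \<open>Outside \<open>T\<close>, the set \<open>Z\<close> uses the coordinates of \<open>X\<close> with values that occur there neither in \<open>X\<close>
  nor in \<open>Y\<close>. Three values at each coordinate are enough for this. It is the separation property that
  \<open>unshift_star\<close> asks for.\<close>

lemma star_avoiding_two:
  assumes X: "X \<in> signed_sets n c r" "T \<subseteq> X" and Y: "Y \<in> signed_sets n c r" "T \<subseteq> Y"
    and c: "\<And>x. x \<in> {1..n} \<Longrightarrow> 3 \<le> c x"
  obtains Z where "Z \<in> signed_sets n c r" "T \<subseteq> Z" "Z \<inter> X = T" "Z \<inter> Y = T"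
proof -
  have "\<exists>z\<in>{1..c x}. z \<noteq> y \<and> (x, z) \<notin> Y" if "(x, y) \<in> X" for x y
  proof -
    have "3 \<le> c x" using c signed_setsD(3)[OF X(1) that] by blast
    have "card ({z. (x, z) \<in> Y}) \<le> 1"
      using signed_setsD(5)[OF Y(1), of x] by (intro card_le_Suc0_iff_eq[THEN iffD2, folded One_nat_def])
        (auto intro: finite_subset[of _ "{1..c x}"] dest: signed_setsD(4)[OF Y(1)])
    then have "card (insert y {z. (x, z) \<in> Y}) \<le> 2"
      using card_insert_le_m1[of 2 "{z. (x, z) \<in> Y}" y] by simp
    moreover have "card {1..c x} \<ge> 3" using \<open>3 \<le> c x\<close> by simp
    moreover have "finite (insert y {z. (x, z) \<in> Y})"
      using finite_subset[of "{z. (x, z) \<in> Y}" "{1..c x}"] signed_setsD(4)[OF Y(1)] by blast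
    ultimately have "\<not> {1..c x} \<subseteq> insert y {z. (x, z) \<in> Y}"
      using card_mono[of "insert y {z. (x, z) \<in> Y}" "{1..c x}"] by linarith
    then show ?thesis by blast
  qed
  then obtain v where v: "v x y \<in> {1..c x}" "v x y \<noteq> y" "(x, v x y) \<notin> Y" if "(x, y) \<in> X" for x y
    by metis
  let ?w = "\<lambda>x y. if (x, y) \<in> T then y else v x y"
  define Z where "Z = (\<lambda>(x, y). (x, ?w x y)) ` X"
  have mem: "q \<in> Z \<longleftrightarrow> q \<in> T \<or> (\<exists>x y. (x, y) \<in> X \<and> (x, y) \<notin> T \<and> q = (x, v x y))" for q
    unfolding Z_def using X(2) by (cases q) (force simp: image_iff)
  have TZ: "T \<subseteq> Z" using mem by blast
  have new: "q \<notin> X \<and> q \<notin> Y" if q: "q \<in> Z" "q \<notin> T" for q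
  proof -
    obtain x y where xy: "(x, y) \<in> X" "q = (x, v x y)" using mem[THEN iffD1, OF q(1)] q(2) by blast
    have "(x, v x y) \<notin> X" using v(2)[OF xy(1)] signed_setsD(5)[OF X(1) xy(1), of "v x y"] by auto
    then show ?thesis using v(3)[OF xy(1)] xy(2) by simp
  qed
  show ?thesis
  proof (rule that[of Z])
    have "?w x y \<in> {1..c x}" if "(x, y) \<in> X" for x y
      using v(1)[OF that] signed_setsD(4)[OF X(1) that] by simp
    then show "Z \<in> signed_sets n c r" unfolding Z_def by (rule relabel_signed_set[OF X(1)])
    show "Z \<inter> X = T" "Z \<inter> Y = T" using new TZ X(2) Y(2) by blast+
  qed (rule TZ)
qed

text \<open>Beyond the \<open>t\<close> prescribed pairs, a signed set is given by its further coordinates \<open>I\<close> and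
  by an independent choice of a value at each of them.\<close>

lemma card_signed_sets_fix:
  assumes tr: "t \<le> r" and rn: "r \<le> n" and c: "\<And>x. x \<in> {1..n} \<Longrightarrow> 0 < c x"
  shows "card (signed_sets_fix n c r t) = (\<Sum>I\<in>nsets {t+1..n} (r - t). \<Prod>i\<in>I. c i)"
proof -
  let ?base = "(\<lambda>x. (x, 1 :: nat)) ` {1..t}"
  let ?dom = "SIGMA I:nsets {t+1..n} (r - t). PiE I (\<lambda>i. {1..c i})"
  let ?f = "\<lambda>(I, y). ?base \<union> (\<lambda>x. (x, y x)) ` I"
  have I: "finite I" "card I = r - t" "I \<subseteq> {t+1..n}" if "I \<in> nsets {t+1..n} (r - t)" for I
    using that by (auto simp: nsets_def)
  have "bij_betw ?f ?dom (signed_sets_fix n c r t)"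
  proof (rule bij_betw_imageI)
    show "inj_on ?f ?dom"
    proof (rule inj_onI, clarify)
      fix I y J z
      assume IJ: "I \<in> nsets {t+1..n} (r - t)" "J \<in> nsets {t+1..n} (r - t)"
        and y: "y \<in> PiE I (\<lambda>i. {1..c i})" and z: "z \<in> PiE J (\<lambda>i. {1..c i})"
        and eq: "?base \<union> (\<lambda>x. (x, y x)) ` I = ?base \<union> (\<lambda>x. (x, z x)) ` J"
      have mem: "(a, b) \<in> ?base \<union> (\<lambda>x. (x, h x)) ` K \<longleftrightarrow> a \<in> K \<and> b = h a"
        if "t < a" for a b and h :: "nat \<Rightarrow> nat" and K
        using that by auto
      have "a \<in> I \<and> b = y a \<longleftrightarrow> a \<in> J \<and> b = z a" if "t < a" for a b
        using mem[OF that, of b y I] mem[OF that, of b z J] unfolding eq by metis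
      moreover have "t < a" if "a \<in> I \<or> a \<in> J" for a
        using that I(3)[OF IJ(1)] I(3)[OF IJ(2)] by (auto simp: subset_eq)
      ultimately have *: "a \<in> I \<and> b = y a \<longleftrightarrow> a \<in> J \<and> b = z a" for a b by blast
      then have "I = J" by blast
      moreover have "y = z"
      proof (rule PiE_ext[OF y])
        show "z \<in> PiE I (\<lambda>i. {1..c i})" using z \<open>I = J\<close> by simp
      qed (use * in blast)
      ultimately show "I = J \<and> y = z" by simp
    qed
    show "?f ` ?dom = signed_sets_fix n c r t"
    proof (intro equalityI subsetI)
      fix A assume "A \<in> ?f ` ?dom"
      then obtain I y where Iy: "I \<in> nsets {t+1..n} (r - t)" "y \<in> PiE I (\<lambda>i. {1..c i})"
        and A: "A = ?base \<union> (\<lambda>x. (x, y x)) ` I" by auto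
      let ?y = "\<lambda>x. if x \<le> t then 1 else y x"
      have big: "t < x" "x \<le> n" if "x \<in> I" for x using I(3)[OF Iy(1)] that by auto
      have "A = (\<lambda>x. (x, ?y x)) ` ({1..t} \<union> I)"
        unfolding A image_Un using big by (intro arg_cong2[where f = "(\<union>)"] image_cong) fastforce+
      moreover have "{1..t} \<union> I \<in> nsets {1..n} r"
      proof -
        have "{1..t} \<inter> I = {}" using big by fastforce
        then have "card ({1..t} \<union> I) = r"
          using I(1,2)[OF Iy(1)] tr by (subst card_Un_disjoint) auto
        moreover have "{1..t} \<union> I \<subseteq> {1..n}" using big tr rn by fastforce
        ultimately show ?thesis using I(1)[OF Iy(1)] by (simp add: nsets_def)
      qed
      moreover have "\<forall>x\<in>{1..t} \<union> I. ?y x \<in> {1..c x}"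
        using Iy(2) big c tr rn by (fastforce simp: Suc_le_eq PiE_def Pi_def)
      ultimately have "A \<in> signed_sets n c r"
        unfolding signed_sets_def mem_Collect_eq
        by (intro exI[of _ "{1..t} \<union> I"], intro exI[of _ ?y]) blast
      then show "A \<in> signed_sets_fix n c r t" unfolding signed_sets_fix_def A by blast
    next
      fix A assume "A \<in> signed_sets_fix n c r t"
      then have AS: "A \<in> signed_sets n c r" and base: "\<And>x. x \<in> {1..t} \<Longrightarrow> (x, 1) \<in> A"
        by (auto simp: signed_sets_fix_def)
      let ?I = "fst ` A - {1..t}"
      define y where "y = restrict (\<lambda>x. THE b. (x, b) \<in> A) ?I"
      have yA: "(THE b. (x, b) \<in> A) = b" if "(x, b) \<in> A" for x b
        using that signed_setsD(5)[OF AS] by blast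
      have "card (fst ` A) = r" using AS by (simp add: signed_sets_iff card_image)
      moreover have "{1..t} \<subseteq> fst ` A" using base by force
      ultimately have "card ?I = r - t" using signed_setsD(1)[OF AS] by (simp add: card_Diff_subset)
      moreover have "?I \<subseteq> {t+1..n}" using signed_setsD(3)[OF AS] by fastforce
      ultimately have I': "?I \<in> nsets {t+1..n} (r - t)"
        using signed_setsD(1)[OF AS] by (simp add: nsets_def)
      have y': "y \<in> PiE ?I (\<lambda>i. {1..c i})"
        unfolding y_def restrict_PiE_iff
      proof
        fix x assume x: "x \<in> ?I"
        then obtain b where b: "(x, b) \<in> A" by auto
        then show "(THE b. (x, b) \<in> A) \<in> {1..c x}" using yA[OF b] signed_setsD(4)[OF AS b] by simp
      qed
      have mem: "(a, b) \<in> A \<longleftrightarrow> (a, b) \<in> ?base \<union> (\<lambda>x. (x, y x)) ` ?I" for a b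
      proof (cases "a \<in> {1..t}")
        case True
        have "(a, b) \<in> A \<longleftrightarrow> b = 1" using signed_setsD(5)[OF AS] base[OF True] by blast
        then show ?thesis using True by auto
      next
        case False
        have "(a, b) \<in> A \<longleftrightarrow> a \<in> fst ` A \<and> b = (THE b. (a, b) \<in> A)"
        proof
          assume "(a, b) \<in> A"
          then show "a \<in> fst ` A \<and> b = (THE b. (a, b) \<in> A)" using yA by (metis fst_conv imageI)
        next
          assume R: "a \<in> fst ` A \<and> b = (THE b. (a, b) \<in> A)"
          then obtain d where "(a, d) \<in> A" by auto
          then show "(a, b) \<in> A" using yA R by metis
        qed
        also have "\<dots> \<longleftrightarrow> a \<in> ?I \<and> b = y a" using False by (simp add: y_def)
        also have "\<dots> \<longleftrightarrow> (a, b) \<in> (\<lambda>x. (x, y x)) ` ?I" by blast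
        also have "\<dots> \<longleftrightarrow> (a, b) \<in> ?base \<union> (\<lambda>x. (x, y x)) ` ?I" using False by blast
        finally show ?thesis .
      qed
      have "A = ?base \<union> (\<lambda>x. (x, y x)) ` ?I"
        by (intro equalityI subrelI) (simp_all only: mem)
      then have "A = ?f (?I, y)" by (simp only: prod.case)
      moreover have "(?I, y) \<in> ?dom" by (rule SigmaI) (rule I', rule y')
      ultimately show "A \<in> ?f ` ?dom" by (rule image_eqI)
    qed
  qed
  then have "card (signed_sets_fix n c r t) = card ?dom" by (simp add: bij_betw_same_card)
  also have "\<dots> = (\<Sum>I\<in>nsets {t+1..n} (r - t). card (PiE I (\<lambda>i. {1..c i})))"
    using I by (intro card_SigmaI) (auto simp: finite_imp_finite_nsets intro: finite_PiE)
  also have "\<dots> = (\<Sum>I\<in>nsets {t+1..n} (r - t). \<Prod>i\<in>I. c i)"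
    using I(1) by (intro sum.cong refl) (simp add: card_PiE)
  finally show ?thesis .
qed

section \<open>Intersecting families of signed sets\<close>

text \<open>Induction on the sum of all values in all members, which every effective shift lowers. A
  family that no shift \<open>(x, y) \<rightarrow> (x, 1)\<close> changes is compared with the weight of its traces. If equality holds there, it
  contains every signed set whose trace belongs to the extremal family of traces, which is a star, so
  the family is a star whose core has all values 1.\<close>

lemma signed_t_intersecting:
  assumes t: "1 \<le> t" "t \<le> r" and rn: "r \<le> n" and u: "0 \<le> u"
    and IP: "IP_sequence n c" and c1: "real (c 1) \<ge> real t + u + 1"
  shows "\<A> \<subseteq> signed_sets n c r \<Longrightarrow> t_intersecting t \<A> \<Longrightarrow>
    card \<A> \<le> card (signed_sets_fix n c r t) \<and>
    (0 < u \<longrightarrow> card \<A> = card (signed_sets_fix n c r t) \<longrightarrow>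
      (\<exists>T\<in>signed_sets n c t. \<A> = star (signed_sets n c r) T))"
proof (induction "\<Sum>A\<in>\<A>. sum snd A" arbitrary: \<A> rule: less_induct)
  case (less \<A>)
  note sub = less.prems(1) and int = less.prems(2)
  let ?S = "signed_sets n c r"
  let ?M = "card (signed_sets_fix n c r t)"
  have finA: "finite \<A>" by (rule finite_subset[OF sub finite_signed_sets])
  have fin: "finite A" if "A \<in> ?S" for A by (rule signed_setsD(1)[OF that])
  have cpos: "0 < c x" if "x \<in> {1..n}" for x using IP that by (auto simp: IP_sequence_def)
  have c_ge: "real t + u + 1 \<le> real (c x)" if "x \<in> {1..n}" for x
  proof -
    have "1 \<in> {1..n}" "1 \<le> x" using that by auto
    then have "c 1 \<le> c x" using IP that unfolding IP_sequence_def by blast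
    then show ?thesis using c1 by linarith
  qed
  show ?case
  proof (cases "\<exists>x\<in>{1..n}. \<exists>y\<in>{2..c x}. shift (x, 1) (x, y) \<A> \<noteq> \<A>")
    case True
    then obtain x y where xy: "x \<in> {1..n}" "y \<in> {2..c x}" "shift (x, 1) (x, y) \<A> \<noteq> \<A>" by blast
    let ?p = "(x, 1 :: nat)" and ?q = "(x, y)"
    let ?B = "shift ?p ?q \<A>"
    have pq: "?p \<noteq> ?q" using xy(2) by auto
    have host: "insert ?p (A - {?q}) \<in> ?S" if "A \<in> ?S" "?q \<in> A" for A
      by (rule replace_value[OF that]) (use xy(2) in auto)
    have Bsub: "?B \<subseteq> ?S"
    proof
      fix B assume "B \<in> ?B"
      then obtain A where A: "A \<in> \<A>" "B = shift_map ?p ?q \<A> A" by (auto simp: shift_def)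
      show "B \<in> ?S"
        using A sub host[of A] unfolding A(2) shift_map_def moved_def by (simp split: if_split) blast
    qed
    have Bint: "t_intersecting t ?B"
      by (rule t_intersecting_shift[OF _ pq int]) (use fin sub in blast)
    have "(\<Sum>A\<in>?B. sum snd A) < (\<Sum>A\<in>\<A>. sum snd A)"
    proof (rule shift_decreases[OF finA _ _ xy(3)])
      show "finite A" if "A \<in> \<A>" for A using fin sub that by blast
      show "snd ?p < snd ?q" using xy(2) by simp
    qed
    from less.hyps[OF this Bsub Bint]
    have IH: "card ?B \<le> ?M" "0 < u \<Longrightarrow> card ?B = ?M \<Longrightarrow> \<exists>T\<in>signed_sets n c t. ?B = star ?S T"
      by auto
    show ?thesis
    proof (intro conjI impI)
      show "card \<A> \<le> ?M" using IH(1) by (simp add: card_shift)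
      assume upos: "0 < u" and "card \<A> = ?M"
      then obtain T where T: "T \<in> signed_sets n c t" "?B = star ?S T"
        using IH(2) by (auto simp: card_shift)
      have three: "3 \<le> c z" if "z \<in> {1..n}" for z
      proof -
        have "2 < real (c z)" using c_ge[OF that] upos t(1) by linarith
        then show ?thesis by linarith
      qed
      have "\<A> = star ?S T \<or> ?p \<in> T \<and> ?q \<notin> T \<and> \<A> = star ?S (insert ?q (T - {?p}))"
      proof (rule unshift_star[OF sub int signed_setsD(1,2)[OF T(1)] pq T(2) host])
        fix X Y
        assume p: "?p \<in> T" and X: "X \<in> ?S" "T \<subseteq> X" and Y: "Y \<in> ?S" "T \<subseteq> Y"
        obtain Z where Z: "Z \<in> ?S" "T \<subseteq> Z" "Z \<inter> X = T" "Z \<inter> Y = T"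
          by (rule star_avoiding_two[OF X Y three])
        have "?q \<notin> Z" using signed_setsD(5)[OF Z(1), of x 1 y] p Z(2) pq by blast
        then show "\<exists>Z\<in>?S. T \<subseteq> Z \<and> ?q \<notin> Z \<and> Z \<inter> X = T \<and> Z \<inter> Y = T" using Z by blast
      qed
      moreover have "insert ?q (T - {?p}) \<in> signed_sets n c t" if "?p \<in> T"
        by (rule replace_value[OF T(1) that]) (use xy(2) in auto)
      ultimately show "\<exists>T\<in>signed_sets n c t. \<A> = star ?S T" using T(1) by blast
    qed
  next
    case False
    let ?g = "trace_count n c r"
    let ?\<T> = "ones ` \<A>"
    have g: "decaying_weight n r t (real t + u) ?g"
      by (rule decaying_weight_trace_count[OF IP rn]) (use c1 t u in linarith)+
    have Tsub: "?\<T> \<subseteq> bounded_subsets n r" using ones_bounded sub by blast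
    have Tint: "t_intersecting t ?\<T>"
      by (rule t_intersecting_ones[OF sub int]) (use False in blast)
    have M: "sum ?g {T. T \<subseteq> {1..n} \<and> {1..t} \<subseteq> T} = real ?M"
      unfolding signed_sets_fix_eq by (rule sum_trace_count) simp
    have "real t \<le> real t + u" "t \<le> n" using u t rn by linarith+
    from weighted_t_intersecting[OF t this g Tsub Tint]
    have W: "sum ?g ?\<T> \<le> real ?M" "0 < u \<Longrightarrow> sum ?g ?\<T> = real ?M \<Longrightarrow>
      \<exists>T\<subseteq>{1..n}. card T = t \<and> ?\<T> = star (bounded_subsets n r) T"
      unfolding M by auto
    \<comment> \<open>The weight of the traces counts every signed set that has one of them as its trace.\<close>
    let ?full = "{A \<in> ?S. ones A \<in> ?\<T>}"
    have full: "sum ?g ?\<T> = real (card ?full)" using finA by (intro sum_trace_count) simp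
    have Afull: "\<A> \<subseteq> ?full" using sub by blast
    have finfull: "finite ?full" using finite_signed_sets by simp
    have le: "card \<A> \<le> card ?full" by (rule card_mono[OF finfull Afull])
    have le': "card ?full \<le> ?M" using W(1) unfolding full by simp
    show ?thesis
    proof (intro conjI impI)
      show "card \<A> \<le> ?M" using le le' by simp
      assume upos: "0 < u" and eq: "card \<A> = ?M"
      then have "card \<A> = card ?full" "card ?full = ?M" using le le' by auto
      then have "\<A> = ?full" using card_subset_eq[OF finfull Afull] by simp
      obtain T where T: "T \<subseteq> {1..n}" "card T = t" "?\<T> = star (bounded_subsets n r) T"
        using W(2) upos \<open>card ?full = ?M\<close> unfolding full by auto
      have "ones A \<in> ?\<T> \<longleftrightarrow> (\<lambda>x. (x, 1)) ` T \<subseteq> A" if "A \<in> ?S" for A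
        unfolding T(3) star_def using ones_bounded[OF that] by (auto simp: ones_def)
      then have "?full = star ?S ((\<lambda>x. (x, 1)) ` T)" unfolding star_def by blast
      then have "\<A> = star ?S ((\<lambda>x. (x, 1)) ` T)" using \<open>\<A> = ?full\<close> by simp
      then show "\<exists>T\<in>signed_sets n c t. \<A> = star ?S T"
        by (rule bexI[OF _ signed_set_ones[OF T(1,2) cpos]])
    qed
  qed
qed

theorem theorem2p5:
  fixes n r t :: nat and u :: real and c :: "nat \<Rightarrow> nat" and \<A> :: "(nat \<times> nat) set set"
  assumes "1 \<le> t" and "t \<le> r" and "r \<le> n"
    and "0 \<le> u" and "u > (6 - real t) / 3"
    and "IP_sequence n c" and "real (c 1) \<ge> real t + u + 1"
    and "\<A> \<subseteq> signed_sets n c r" and "t_intersecting t \<A>"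
  shows "card \<A> \<le> (\<Sum>I\<in>nsets {t+1..n} (r - t). \<Prod>i\<in>I. c i) \<and>
    (u > 0 \<longrightarrow>
      (card \<A> = (\<Sum>I\<in>nsets {t+1..n} (r - t). \<Prod>i\<in>I. c i) \<longleftrightarrow>
        (\<exists>T\<in>signed_sets n c t. \<A> = star (signed_sets n c r) T \<and>
          card (star (signed_sets n c r) T) = card (signed_sets_fix n c r t))))"
proof -
  have cpos: "0 < c x" if "x \<in> {1..n}" for x using assms(6) that by (auto simp: IP_sequence_def)
  have count: "(\<Sum>I\<in>nsets {t+1..n} (r - t). \<Prod>i\<in>I. c i) = card (signed_sets_fix n c r t)"
    by (rule card_signed_sets_fix[OF assms(2,3) cpos, symmetric])
  note main = signed_t_intersecting[OF assms(1-4,6-9)]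
  show ?thesis
    unfolding count
  proof (intro conjI impI iffI)
    show "card \<A> \<le> card (signed_sets_fix n c r t)" using main by blast
    assume "0 < u" and eq: "card \<A> = card (signed_sets_fix n c r t)"
    then obtain T where "T \<in> signed_sets n c t" "\<A> = star (signed_sets n c r) T" using main by blast
    then show "\<exists>T\<in>signed_sets n c t. \<A> = star (signed_sets n c r) T \<and>
        card (star (signed_sets n c r) T) = card (signed_sets_fix n c r t)" using eq by blast
  qed auto
qed

end
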